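(* Let $\Delta\subset\mathbb{R}^n$ be a regular integral polytope and let $y\in\mathbb{R}$, $y\neq -1$. For any polarizing vector $\xi=(\xi_1,\dots,\xi_n)\in\mathbb{R}^n$ for $\Delta$, setting $z_j=e^{\xi_j}$ and $z^p=z_1^{p_1}\cdots z_n^{p_n}=e^{\langle p,\xi\rangle}$ for $p=(p_1,\dots,p_n)\in\mathbb{Z}^n$, one has $$\sum_{v}(-1)^{\#v}\sum_{p\in \mathbf{C}^\sharp_v\cap\mathbb{Z}^n} w_v(p)\,z^p=\sum_{p\in\Delta\cap\mathbb{Z}^n}\left(\frac{1}{1+y}\right)^{c(p)}z^p,$$ where the outer sum on the left is over all vertices $v$ of $\Delta$.
   Context: A polytope in $\mathbb{R}^n$ is a compact convex set of full dimension $n$ that is a finite intersection of closed half-spaces. It is simple if exactly $n$ edges emanate from each vertex. It is regular if it is simple and, for each vertex, the lines along the edges emanating from it are generated by a $\mathbb{Z}$-basis of $\mathbb{Z}^n$. It is integral if its vertices lie in $\mathbb{Z}^n$. $\langle\cdot,\cdot\rangle$ is the standard pairing on $\mathbb{R}^n$. For a regular integral polytope $\Delta$ and a vertex $v$, let $\alpha_{1,v},\dots,\alpha_{n,v}\in\mathbb{Z}^n$ be the primitive lattice vectors along the edges at $v$, pointing from $v$ to other vertices of $\Delta$ (they form a $\mathbb{Z}$-basis of $\mathbb{Z}^n$). A polarizing vector for $\Delta$ is a vector $\xi\in\mathbb{R}^n$ with $\langle\alpha_{j,v},\xi\rangle\neq 0$ for all $v$ and $j$. Given $\xi$, set $\alpha^\sharp_{j,v}=\alpha_{j,v}$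 if $\langle\alpha_{j,v},\xi\rangle<0$ (unflipped), and $\alpha^\sharp_{j,v}=-\alpha_{j,v}$ if $\langle\alpha_{j,v},\xi\rangle>0$ (flipped). Let $\#v$ be the number of flipped edge vectors at $v$. The polarized tangent cone at $v$ is $\mathbf{C}^\sharp_v=v+\sum_{j=1}^n\mathbb{R}_{\ge 0}\alpha^\sharp_{j,v}$. Every $p\in\mathbf{C}^\sharp_v\cap\mathbb{Z}^n$ is uniquely written as $p=v+\sum_{j=1}^n m_j\alpha^\sharp_{j,v}$ with $m_j\in\mathbb{Z}_{\ge0}$. Let $r_{1,v}(p)$ be the number of indices $j$ with $m_j=0$ and $\alpha_{j,v}$ unflipped, and $r_{2,v}(p)$ the number of indices $j$ with $m_j=0$ and $\alpha_{j,v}$ flipped. (So $r_{1,v}(p)+r_{2,v}(p)$ is the codimension of the smallest dimensional face of $\mathbf{C}^\sharp_v$ containing $p$.) Define $$w_v(p)=\left(\frac{1}{1+y}\right)^{r_{1,v}(p)}\left(\frac{y}{1+y}\right)^{r_{2,v}(p)},$$ with the convention that a zeroth power equals $1$ (also when $y=0$), and $w_v(p)=0$ if $p\notin\mathbf{C}^\sharp_v$. For $p\in\Delta$, $c(p)$ is the codimension (in $\mathbb{R}^n$) of the smallest dimensional face of $\Delta$ containing $p$; $c(p)=0$ for $p$ in the interior of $\Delta$. *)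

theory Defs
  imports "HOL-Analysis.Analysis"
begin

definition int_lattice :: "(real ^ 'n) set" where
  "int_lattice = {x. \<forall>i. x $ i \<in> \<int>}"

definition int_basis :: "(real ^ 'n) set \<Rightarrow> bool" where
  "int_basis B \<longleftrightarrow> finite B \<and> B \<subseteq> int_lattice \<and>
     (\<forall>x\<in>int_lattice. \<exists>!k::real ^ 'n \<Rightarrow> int.
        (\<forall>b. b \<notin> B \<longrightarrow> k b = 0) \<and> x = (\<Sum>b\<in>B. of_int (k b) *\<^sub>R b))"

definition primitive_vector :: "real ^ 'n \<Rightarrow> bool" where
  "primitive_vector a \<longleftrightarrow> a \<in> int_lattice \<and> a \<noteq> 0 \<and>
     (\<forall>(k::int) b. b \<in> int_lattice \<and> a = of_int k *\<^sub>R b \<longrightarrow> \<bar>k\<bar> = 1)"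

(* Not to be confused with the library's polytope, which is not required to be
   full-dimensional; polyhedron is the library's finite intersection of closed half-spaces. *)
definition full_polytope :: "(real ^ 'n) set \<Rightarrow> bool" where
  "full_polytope S \<longleftrightarrow> compact S \<and> convex S \<and> polyhedron S \<and> aff_dim S = int CARD('n)"

definition vertices :: "(real ^ 'n) set \<Rightarrow> (real ^ 'n) set" where
  "vertices S = {v. v extreme_point_of S}"

definition edges_at :: "(real ^ 'n) set \<Rightarrow> real ^ 'n \<Rightarrow> (real ^ 'n) set set" where
  "edges_at S v = {e. e edge_of S \<and> v \<in> e}"

definition simple_polytope :: "(real ^ 'n) set \<Rightarrow> bool" where
  "simple_polytope S \<longleftrightarrow> full_polytope S \<and>
     (\<forall>v\<in>vertices S. finite (edges_at S v) \<and> card (edges_at S v) = CARD('n))"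

definition regular_polytope :: "(real ^ 'n) set \<Rightarrow> bool" where
  "regular_polytope S \<longleftrightarrow> simple_polytope S \<and>
     (\<forall>v\<in>vertices S. \<exists>B. int_basis B \<and>
        (\<lambda>e. affine hull e) ` edges_at S v = (\<lambda>b. range (\<lambda>t::real. v + t *\<^sub>R b)) ` B)"

definition integral_polytope :: "(real ^ 'n) set \<Rightarrow> bool" where
  "integral_polytope S \<longleftrightarrow> full_polytope S \<and> vertices S \<subseteq> int_lattice"

(* The vectors \<alpha>_{1,v}, ..., \<alpha>_{n,v}. They are pairwise distinct, so they are kept
   as a set of vectors and serve as their own indices. *)
definition edge_vectors :: "(real ^ 'n) set \<Rightarrow> real ^ 'n \<Rightarrow> (real ^ 'n) set" where
  "edge_vectors S v = {a. primitive_vector a \<and>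
     (\<exists>e\<in>edges_at S v. \<exists>w\<in>vertices S. \<exists>t>0. w \<in> e \<and> w = v + t *\<^sub>R a)}"

definition polarizing :: "(real ^ 'n) set \<Rightarrow> real ^ 'n \<Rightarrow> bool" where
  "polarizing S \<xi> \<longleftrightarrow> (\<forall>v\<in>vertices S. \<forall>a\<in>edge_vectors S v. a \<bullet> \<xi> \<noteq> 0)"

definition unflipped :: "(real ^ 'n) set \<Rightarrow> real ^ 'n \<Rightarrow> real ^ 'n \<Rightarrow> (real ^ 'n) set" where
  "unflipped S \<xi> v = {a \<in> edge_vectors S v. a \<bullet> \<xi> < 0}"

definition flipped :: "(real ^ 'n) set \<Rightarrow> real ^ 'n \<Rightarrow> real ^ 'n \<Rightarrow> (real ^ 'n) set" where
  "flipped S \<xi> v = {a \<in> edge_vectors S v. a \<bullet> \<xi> > 0}"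

definition polarize :: "real ^ 'n \<Rightarrow> real ^ 'n \<Rightarrow> real ^ 'n" where
  "polarize \<xi> a = (if a \<bullet> \<xi> < 0 then a else - a)"

definition polarized_cone :: "(real ^ 'n) set \<Rightarrow> real ^ 'n \<Rightarrow> real ^ 'n \<Rightarrow> (real ^ 'n) set" where
  "polarized_cone S \<xi> v =
     {v + (\<Sum>a\<in>edge_vectors S v. c a *\<^sub>R polarize \<xi> a) | c :: real ^ 'n \<Rightarrow> real.
        \<forall>a\<in>edge_vectors S v. c a \<ge> 0}"

(* The coefficients m_j of p; meaningful for lattice points p of the polarized cone. *)
definition cone_coords ::
  "(real ^ 'n) set \<Rightarrow> real ^ 'n \<Rightarrow> real ^ 'n \<Rightarrow> real ^ 'n \<Rightarrow> real ^ 'n \<Rightarrow> nat" where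
  "cone_coords S \<xi> v p = (THE m. (\<forall>a. a \<notin> edge_vectors S v \<longrightarrow> m a = 0) \<and>
     p = v + (\<Sum>a\<in>edge_vectors S v. real (m a) *\<^sub>R polarize \<xi> a))"

definition r1 :: "(real ^ 'n) set \<Rightarrow> real ^ 'n \<Rightarrow> real ^ 'n \<Rightarrow> real ^ 'n \<Rightarrow> nat" where
  "r1 S \<xi> v p = card {a \<in> unflipped S \<xi> v. cone_coords S \<xi> v p a = 0}"

definition r2 :: "(real ^ 'n) set \<Rightarrow> real ^ 'n \<Rightarrow> real ^ 'n \<Rightarrow> real ^ 'n \<Rightarrow> nat" where
  "r2 S \<xi> v p = card {a \<in> flipped S \<xi> v. cone_coords S \<xi> v p a = 0}"

definition cone_weight ::
  "real \<Rightarrow> (real ^ 'n) set \<Rightarrow> real ^ 'n \<Rightarrow> real ^ 'n \<Rightarrow> real ^ 'n \<Rightarrow> real" where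
  "cone_weight y S \<xi> v p =
     (if p \<in> polarized_cone S \<xi> v
      then (1 / (1 + y)) ^ r1 S \<xi> v p * (y / (1 + y)) ^ r2 S \<xi> v p
      else 0)"

(* Any p in a convex S lies in the face S itself, and every face containing p has affine
   dimension at least 0, so the least dimension exists. *)
definition face_codim :: "(real ^ 'n) set \<Rightarrow> real ^ 'n \<Rightarrow> nat" where
  "face_codim S p =
     CARD('n) - (LEAST d. \<exists>F. F face_of S \<and> p \<in> F \<and> aff_dim F = int d)"

(* z^p for z with positive entries and p in the integer lattice. *)
definition monomial :: "real ^ 'n \<Rightarrow> real ^ 'n \<Rightarrow> real" where
  "monomial z p = (\<Prod>j\<in>UNIV. (z $ j) powr (p $ j))"

lemma monomial_exp:
  fixes p \<xi> :: "real ^ 'n"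
  shows "monomial (\<chi> j. exp (\<xi> $ j)) p = exp (p \<bullet> \<xi>)"
  by (simp add: monomial_def powr_def inner_vec_def exp_sum)

lemma finite_bounded_int_lattice:
  fixes S :: "(real ^ 'n) set"
  assumes "bounded S"
  shows "finite (S \<inter> int_lattice)"
proof -
  obtain B where B: "\<And>x. x \<in> S \<Longrightarrow> norm x \<le> B"
    using assms by (auto simp: bounded_iff)
  let ?J = "{k :: real. k \<in> \<int> \<and> \<bar>k\<bar> \<le> B}"
  have "finite ?J"
    by (rule finite_abs_int_segment)
  then have "finite (PiE (UNIV :: 'n set) (\<lambda>_. ?J))"
    by (intro finite_PiE) auto
  then have "finite (vec_lambda ` (PiE (UNIV :: 'n set) (\<lambda>_. ?J)))"
    by (rule finite_imageI)
  moreover have "S \<inter> int_lattice \<subseteq> vec_lambda ` (PiE (UNIV :: 'n set) (\<lambda>_. ?J))"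
  proof
    fix x assume x: "x \<in> S \<inter> int_lattice"
    have "\<bar>x $ i\<bar> \<le> B" for i
      using component_le_norm_cart[of x i] B[of x] x by auto
    with x have "vec_nth x \<in> PiE (UNIV :: 'n set) (\<lambda>_. ?J)"
      by (auto simp: int_lattice_def)
    moreover have "x = vec_lambda (vec_nth x)"
      by simp
    ultimately show "x \<in> vec_lambda ` (PiE (UNIV :: 'n set) (\<lambda>_. ?J))"
      by blast
  qed
  ultimately show ?thesis
    by (rule rev_finite_subset)
qed

end

theory Submission
  imports Defs
begin

text \<open>
  The identity already holds at each single lattice point \<open>p\<close>: put \<open>t = 1 / (1 + y)\<close>; the
  signed weights of \<open>p\<close> in all polarized cones add up to \<open>t\<close> to the power \<open>c(p)\<close> if \<open>p\<close> lies
  in the polytope, and to \<open>0\<close> otherwise (lemma \<open>signed_cone_weights_eq\<close>). Multiplying by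
  \<open>exp (p \<bullet> \<xi>)\<close> and summing over \<open>p\<close> gives the theorem. The sums converge because every generator
  of a polarized cone has negative inner product with \<open>\<xi>\<close>, so that each of them is a product of
  geometric series with finitely many modified terms (lemma \<open>cone_weight_summable\<close>).

  For the pointwise identity, describe the polytope by its facet inequalities \<open>slack h \<ge> 0\<close>. The
  edge vectors at a vertex \<open>v\<close> are, up to positive factors, the basis dual to the inner facet
  normals at \<open>v\<close> (lemma \<open>regular_polytope_simple_inequalities\<close>). Hence the coordinates of \<open>p - v\<close>
  along the edges have the signs of the slacks of \<open>p\<close>, and the same few numbers describe \<open>p\<close> at all
  vertices: let \<open>c h\<close> be \<open>1\<close>, \<open>t\<close> or \<open>0\<close> according to whether \<open>slack h p\<close> is positive, zero or
  negative. The signed weight of \<open>p\<close> at \<open>v\<close> is the product, over the facets \<open>h\<close> through \<open>v\<close>, of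
  \<open>c h\<close> if the edge leaving \<open>h\<close> is unflipped and of \<open>c h - 1\<close> if it is flipped
  (lemma \<open>signed_cone_weight\<close>; a flipped edge uses the complementary half-space, and
  \<open>t - 1 = - (y / (1 + y))\<close>). As \<open>c(p)\<close> is the number of facets through \<open>p\<close>, the right-hand side is
  the product of \<open>c h\<close> over all facets. What remains is that the sum over the vertices of the
  products over the facets through them equals the product over all facets
  (lemma \<open>vertex_sum_eq_prod\<close>).

  This is proved by moving \<open>p\<close> in a direction \<open>d\<close> with \<open>d \<bullet> \<xi> > 0\<close>. Far away \<open>p\<close> has left the
  polytope and all polarized cones, and both sides vanish. On the way, something happens only when
  \<open>p\<close> crosses the hyperplane of a facet \<open>h\<close>. Both sides are affine functions of the number \<open>c h\<close>, and
  their slopes are the two sides of the same identity for the facet \<open>h\<close> as a polytope; so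
  induction on the dimension applies, once the identity is stated for all faces. Several
  hyperplanes may be crossed at once. This is harmless because the identity is proved for arbitrary
  real numbers \<open>c h\<close> at the facets \<open>h\<close> whose hyperplane contains \<open>p\<close>: they can then be changed one
  after the other.
\<close>

section \<open>Finite systems of linear inequalities\<close>

lemma face_of_tight_inequalities:
  fixes a :: "'f \<Rightarrow> 'a::euclidean_space" and b :: "'f \<Rightarrow> real"
  assumes S: "S = {x. \<forall>h\<in>H. 0 \<le> b h - a h \<bullet> x}" and J: "J \<subseteq> H"
  shows "{x\<in>S. \<forall>h\<in>J. b h - a h \<bullet> x = 0} face_of S"
proof -
  define s where "s h x = b h - a h \<bullet> x" for h x
  have affine: "s h ((1 - u) *\<^sub>R x + u *\<^sub>R y) = (1 - u) * s h x + u * s h y" for h u x y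
    by (simp add: s_def algebra_simps)
  have S: "S = {x. \<forall>h\<in>H. 0 \<le> s h x}" using S by (simp add: s_def)
  have "{x\<in>S. \<forall>h\<in>J. s h x = 0} face_of S"
    unfolding face_of_def
  proof (intro conjI ballI impI)
    let ?G = "{x\<in>S. \<forall>h\<in>J. s h x = 0}"
    show "?G \<subseteq> S" by auto
    show "convex ?G"
      unfolding convex_alt S using J by (auto simp: affine)
    fix x y z assume xy: "x \<in> S" "y \<in> S" and z: "z \<in> ?G" "z \<in> open_segment x y"
    then obtain u where u: "0 < u" "u < 1" "z = (1 - u) *\<^sub>R x + u *\<^sub>R y"
      by (auto simp: in_segment)
    have zero: "s h x = 0 \<and> s h y = 0" if "h \<in> J" for h
    proof -
      have "(1 - u) * s h x + u * s h y = 0"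
        using z that by (auto simp: u(3) affine)
      moreover have "0 \<le> (1 - u) * s h x" "0 \<le> u * s h y"
        using xy that J u unfolding S by (auto intro!: mult_nonneg_nonneg)
      ultimately have "(1 - u) * s h x = 0" "u * s h y = 0" by linarith+
      then show ?thesis using u by auto
    qed
    show "x \<in> ?G" "y \<in> ?G" using zero xy by auto
  qed
  then show ?thesis by (simp add: s_def)
qed

text \<open>
  The constraints that are strict at \<open>p\<close> survive a short step by continuity, so a direction need only
  respect the tight ones.
\<close>

lemma small_step:
  fixes a :: "'f \<Rightarrow> 'a::euclidean_space" and b :: "'f \<Rightarrow> real"
  assumes fin: "finite H" and S: "S = {x. \<forall>h\<in>H. 0 \<le> b h - a h \<bullet> x}" and p: "p \<in> S"
    and d: "\<And>h. h \<in> H \<Longrightarrow> b h - a h \<bullet> p = 0 \<Longrightarrow> a h \<bullet> d \<le> 0"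
  shows "\<exists>e>0. p + e *\<^sub>R d \<in> S"
proof -
  have move: "b h - a h \<bullet> (p + e *\<^sub>R d) = (b h - a h \<bullet> p) - e * (a h \<bullet> d)" for h e
    by (simp add: algebra_simps)
  have "eventually (\<lambda>e. \<forall>h\<in>H. 0 \<le> b h - a h \<bullet> (p + e *\<^sub>R d)) (at_right 0)"
  proof (intro eventually_ball_finite[OF fin] ballI)
    fix h assume h: "h \<in> H"
    show "eventually (\<lambda>e. 0 \<le> b h - a h \<bullet> (p + e *\<^sub>R d)) (at_right 0)"
    proof (cases "b h - a h \<bullet> p = 0")
      case True
      then show ?thesis
        using d[OF h True] unfolding move by (intro eventually_at_rightI[of 0 1])
          (auto simp: mult_nonneg_nonpos)
    next
      case False
      then have "0 < b h - a h \<bullet> p" using p h unfolding S by (force simp: order_less_le)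
      moreover have "((\<lambda>e. b h - a h \<bullet> (p + e *\<^sub>R d)) \<longlongrightarrow> (b h - a h \<bullet> p) - 0 * (a h \<bullet> d)) (at_right 0)"
        unfolding move by (intro tendsto_intros)
      ultimately have "eventually (\<lambda>e. 0 < b h - a h \<bullet> (p + e *\<^sub>R d)) (at_right 0)"
        by (intro order_tendstoD(1)) auto
      then show ?thesis by eventually_elim simp
    qed
  qed
  then have "eventually (\<lambda>e. 0 < e \<and> p + e *\<^sub>R d \<in> S) (at_right 0)"
    using eventually_at_right_less[of 0] unfolding S by eventually_elim auto
  then show ?thesis
    by (rule eventually_happens'[rotated]) simp
qed


section \<open>Signed sums over the vertices of a simple system of inequalities\<close>

definition tight :: "'f set \<Rightarrow> ('f \<Rightarrow> 'a::real_inner) \<Rightarrow> ('f \<Rightarrow> real) \<Rightarrow> 'a \<Rightarrow> 'f set" where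
  "tight H a b x = {h \<in> H. b h - a h \<bullet> x = 0}"

text \<open>
  What the argument uses about a simple polytope \<open>S\<close> with vertex set \<open>V\<close>: \<open>edge v h\<close> is a vector
  along the edge that leaves the vertex \<open>v\<close> inside all facets through \<open>v\<close> other than \<open>h\<close>. Spanning,
  orthogonality and strict decrease together say that these vectors are, up to positive
  factors, the basis dual to the inner normals \<open>- a h\<close> at \<open>v\<close>.
\<close>

locale simple_inequalities =
  fixes H :: "'f set" and a :: "'f \<Rightarrow> 'a::euclidean_space" and b :: "'f \<Rightarrow> real"
    and S V :: "'a set" and edge :: "'a \<Rightarrow> 'f \<Rightarrow> 'a"
  assumes finite_H: "finite H"
    and S_eq: "S = {x. \<forall>h\<in>H. 0 \<le> b h - a h \<bullet> x}"
    and bounded_S: "bounded S"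
    and finite_V: "finite V"
    and V_sub: "V \<subseteq> S"
    and vertex_exists: "\<And>x. x \<in> S \<Longrightarrow> \<exists>v\<in>V. tight H a b x \<subseteq> tight H a b v"
    and spanning: "\<And>v. v \<in> V \<Longrightarrow> span (edge v ` tight H a b v) = UNIV"
    and orthogonal: "\<And>v h h'. v \<in> V \<Longrightarrow> h \<in> tight H a b v \<Longrightarrow> h' \<in> tight H a b v \<Longrightarrow>
                   h' \<noteq> h \<Longrightarrow> a h' \<bullet> edge v h = 0"
    and decreasing: "\<And>v h. v \<in> V \<Longrightarrow> h \<in> tight H a b v \<Longrightarrow> a h \<bullet> edge v h < 0"
begin

abbreviation active :: "'a \<Rightarrow> 'f set" where
  "active \<equiv> tight H a b"

definition slack :: "'f \<Rightarrow> 'a \<Rightarrow> real" where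
  "slack h x = b h - a h \<bullet> x"

lemma active_def: "active x = {h \<in> H. slack h x = 0}"
  by (simp add: tight_def slack_def)

lemma S_slack: "S = {x. \<forall>h\<in>H. 0 \<le> slack h x}"
  by (simp add: S_eq slack_def)

lemma active_sub: "active v \<subseteq> H"
  by (auto simp: active_def)

lemma finite_active: "finite (active v)"
  using finite_H active_sub by (rule rev_finite_subset)

lemma inj_on_edge:
  assumes v: "v \<in> V"
  shows "inj_on (edge v) (active v)"
  by (rule inj_onI) (metis decreasing orthogonal v less_irrefl)

text \<open>
  The coordinates of \<open>x - v\<close> along the edges at \<open>v\<close> are the slacks of \<open>x\<close> up to positive factors.
  Since the slacks do not mention \<open>v\<close>, this links the cones at different vertices.
\<close>

lemma expand_unique:
  assumes v: "v \<in> V" and x: "x - v = (\<Sum>h\<in>active v. k h *\<^sub>R edge v h)" and h: "h \<in> active v"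
  shows "slack h x = k h * - (a h \<bullet> edge v h)"
proof -
  have "a h \<bullet> (x - v) = (\<Sum>g\<in>active v. k g * (a h \<bullet> edge v g))"
    by (simp add: x inner_sum_right)
  also have "\<dots> = (\<Sum>g\<in>active v. if g = h then k h * (a h \<bullet> edge v h) else 0)"
    using orthogonal[OF v _ h] by (intro sum.cong) auto
  also have "\<dots> = k h * (a h \<bullet> edge v h)"
    using h finite_active by simp
  finally show ?thesis
    using h by (simp add: slack_def active_def inner_diff_right)
qed

lemma expand:
  assumes v: "v \<in> V"
  shows "x - v = (\<Sum>h\<in>active v. (slack h x / - (a h \<bullet> edge v h)) *\<^sub>R edge v h)"
proof -
  have "x - v \<in> span (edge v ` active v)"
    using spanning[OF v] by simp
  then obtain u where "x - v = (\<Sum>e\<in>edge v ` active v. u e *\<^sub>R e)"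
    using span_finite[of "edge v ` active v"] finite_active by auto
  then have k: "x - v = (\<Sum>h\<in>active v. u (edge v h) *\<^sub>R edge v h)"
    by (simp add: sum.reindex[OF inj_on_edge[OF v]])
  also have "\<dots> = (\<Sum>h\<in>active v. (slack h x / - (a h \<bullet> edge v h)) *\<^sub>R edge v h)"
  proof (intro sum.cong refl)
    fix h assume h: "h \<in> active v"
    show "u (edge v h) *\<^sub>R edge v h = (slack h x / - (a h \<bullet> edge v h)) *\<^sub>R edge v h"
      using expand_unique[OF v k h] decreasing[OF v h] by simp
  qed
  finally show ?thesis .
qed

lemma slack_move: "slack h (x + s *\<^sub>R d) = slack h x - s * (a h \<bullet> d)"
  by (simp add: slack_def inner_add_right)

text \<open>
  The values of \<open>c\<close> at the constraints that are tight at \<open>p\<close> are left free. The weights put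
  \<open>1 / (1 + y)\<close> there, but the induction has to pass through arbitrary values.
\<close>

definition compatible :: "'a \<Rightarrow> ('f \<Rightarrow> real) \<Rightarrow> bool" where
  "compatible p c \<longleftrightarrow> (\<forall>h\<in>H. (0 < slack h p \<longrightarrow> c h = 1) \<and> (slack h p < 0 \<longrightarrow> c h = 0))"

text \<open>
  A set \<open>I\<close> of constraints that are all tight at some vertex stands for the face on which they are
  tight. \<open>term_at\<close> and \<open>vertex_sum\<close> are the contribution of one vertex and their sum, for this face
  regarded as a polytope in its own affine hull; its facets at \<open>v\<close> come from \<open>active v - I\<close>.
\<close>

definition term_at :: "'a \<Rightarrow> 'f set \<Rightarrow> ('f \<Rightarrow> real) \<Rightarrow> 'a \<Rightarrow> real" where
  "term_at \<xi> I c v = (\<Prod>h\<in>active v - I. if edge v h \<bullet> \<xi> < 0 then c h else c h - 1)"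

definition vertex_sum :: "'a \<Rightarrow> 'f set \<Rightarrow> ('f \<Rightarrow> real) \<Rightarrow> real" where
  "vertex_sum \<xi> I c = (\<Sum>v\<in>{v\<in>V. I \<subseteq> active v}. term_at \<xi> I c v)"

lemma term_at_update_in:
  assumes "h \<in> active v - I"
  shows "term_at \<xi> I (c(h := r)) v - term_at \<xi> I c v = (r - c h) * term_at \<xi> (insert h I) c v"
proof -
  have fin: "finite (active v - I)" using finite_active by auto
  have eq: "active v - I - {h} = active v - insert h I" by auto
  have rest: "(\<Prod>k\<in>active v - insert h I. if edge v k \<bullet> \<xi> < 0 then (c(h := r)) k else (c(h := r)) k - 1)
      = term_at \<xi> (insert h I) c v"
    unfolding term_at_def by (rule prod.cong) auto
  show ?thesis
    unfolding term_at_def[of \<xi> I] prod.remove[OF fin assms] eq rest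
    unfolding term_at_def[symmetric]
    by (simp add: algebra_simps)
qed

lemma term_at_update_notin:
  assumes "h \<notin> active v - I"
  shows "term_at \<xi> I (c(h := r)) v = term_at \<xi> I c v"
  unfolding term_at_def using assms by (intro prod.cong) auto

text \<open>
  The sum is affine in \<open>c h\<close>, and its slope only sees the vertices on which \<open>h\<close> is tight: it is
  the vertex sum of the smaller face \<open>insert h I\<close>. The factors \<open>c h\<close> and \<open>c h - 1\<close> have the same
  slope, so flipping does not matter here.
\<close>

lemma vertex_sum_update:
  assumes "h \<in> H - I"
  shows "vertex_sum \<xi> I (c(h := r)) - vertex_sum \<xi> I c = (r - c h) * vertex_sum \<xi> (insert h I) c"
proof -
  let ?W = "{v\<in>V. I \<subseteq> active v}" and ?U = "{v\<in>V. insert h I \<subseteq> active v}"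
  have "vertex_sum \<xi> I (c(h := r)) - vertex_sum \<xi> I c
      = (\<Sum>v\<in>?W. term_at \<xi> I (c(h := r)) v - term_at \<xi> I c v)"
    by (simp add: vertex_sum_def sum_subtractf)
  also have "\<dots> = (\<Sum>v\<in>?U. term_at \<xi> I (c(h := r)) v - term_at \<xi> I c v)"
    using finite_V assms by (intro sum.mono_neutral_right) (auto intro!: term_at_update_notin)
  also have "\<dots> = (\<Sum>v\<in>?U. (r - c h) * term_at \<xi> (insert h I) c v)"
    using assms by (intro sum.cong refl term_at_update_in) auto
  finally show ?thesis
    by (simp add: vertex_sum_def sum_distrib_left)
qed

lemma prod_update:
  fixes c :: "'f \<Rightarrow> real"
  assumes "h \<in> H - I"
  shows "prod (c(h := r)) (H - I) - prod c (H - I) = (r - c h) * prod c (H - insert h I)"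
proof -
  have fin: "finite (H - I)" using finite_H by auto
  have eq: "H - I - {h} = H - insert h I" by auto
  have "prod (c(h := r)) (H - insert h I) = prod c (H - insert h I)"
    by (rule prod.cong) auto
  then show ?thesis
    unfolding prod.remove[OF fin assms] eq by (simp add: left_diff_distrib)
qed

lemma compatible_nonneg:
  assumes "compatible p c" "h \<in> H" "c h \<noteq> 0"
  shows "0 \<le> slack h p"
  using assms by (force simp: compatible_def)

lemma compatible_nonpos:
  assumes "compatible p c" "h \<in> H" "c h \<noteq> 1"
  shows "slack h p \<le> 0"
  using assms by (force simp: compatible_def)

lemma prod_nonzero_imp_mem:
  assumes "compatible p c" "\<And>h. h \<in> I \<Longrightarrow> slack h p = 0" "prod c (H - I) \<noteq> 0"
  shows "p \<in> S"
proof -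
  have "0 \<le> slack h p" if "h \<in> H" for h
  proof (cases "h \<in> I")
    case False
    then have "c h \<noteq> 0" using assms(3) finite_H that by auto
    then show ?thesis using compatible_nonneg assms(1) that by blast
  qed (simp add: assms(2))
  then show ?thesis by (simp add: S_slack)
qed

text \<open>
  A vertex contributes only if \<open>p\<close> lies in its polarized cone, and the polarized cone lies in the
  half-space on which the inner product with \<open>\<xi>\<close> is at most its value at the apex.
\<close>

lemma term_nonzero_imp_le:
  assumes "compatible p c" "\<And>h. h \<in> I \<Longrightarrow> slack h p = 0" "v \<in> V" "term_at \<xi> I c v \<noteq> 0"
  shows "(p - v) \<bullet> \<xi> \<le> 0"
proof -
  have "slack h p * (edge v h \<bullet> \<xi>) \<le> 0" if h: "h \<in> active v" for h
  proof (cases "h \<in> I")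
    case False
    with h assms(4) finite_active[of v]
    have nz: "(if edge v h \<bullet> \<xi> < 0 then c h else c h - 1) \<noteq> 0"
      by (auto simp: term_at_def)
    have hH: "h \<in> H" using h active_sub by auto
    show ?thesis
      using nz compatible_nonneg[OF assms(1) hH] compatible_nonpos[OF assms(1) hH]
      by (auto split: if_splits intro: mult_nonneg_nonpos mult_nonpos_nonneg)
  qed (simp add: assms(2))
  then have "slack h p / - (a h \<bullet> edge v h) * (edge v h \<bullet> \<xi>) \<le> 0" if "h \<in> active v" for h
    using decreasing[OF assms(3) that] that by (simp add: mult_nonneg_nonpos zero_le_divide_iff)
  then show ?thesis
    unfolding expand[OF assms(3), of p] inner_sum_left inner_scaleR_left by (intro sum_nonpos)
qed

lemma unbounded_ray:
  assumes "\<And>s. 0 \<le> s \<Longrightarrow> p + s *\<^sub>R d \<in> S" shows "d \<bullet> \<xi> \<le> 0"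
proof (rule ccontr)
  assume "\<not> d \<bullet> \<xi> \<le> 0"
  then have nz: "norm d > 0" by auto
  obtain B where B: "\<And>x. x \<in> S \<Longrightarrow> norm x \<le> B" "B > 0"
    using bounded_S bounded_pos by blast
  have "norm (((B + norm p + 1) / norm d) *\<^sub>R d) \<le> norm (p + ((B + norm p + 1) / norm d) *\<^sub>R d) + norm p"
    by (metis add.commute norm_triangle_sub add_diff_cancel_left' diff_minus_eq_add norm_triangle_ineq4)
  also have "\<dots> \<le> B + norm p"
    using B nz by (intro add_right_mono B(1) assms) auto
  finally show False using nz B(2) by auto
qed

text \<open>
  If no value of \<open>c\<close> changes on the whole ray, the point on the ray may be chosen so far out that
  it lies beyond the bounded set \<open>S\<close> and beyond all polarized cones.
\<close>

lemma sums_vanish_far: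
  assumes far: "\<And>s. 0 \<le> s \<Longrightarrow> compatible (p + s *\<^sub>R d) c"
    and pI: "\<And>s h. h \<in> I \<Longrightarrow> slack h (p + s *\<^sub>R d) = 0"
    and d: "0 < d \<bullet> \<xi>"
  shows "vertex_sum \<xi> I c = prod c (H - I)"
proof -
  have "prod c (H - I) = 0"
    using prod_nonzero_imp_mem[OF far pI] unbounded_ray[of p d \<xi>] d by (meson not_less)
  moreover have "term_at \<xi> I c v = 0" if "v \<in> V" for v
  proof (rule ccontr)
    assume nz: "term_at \<xi> I c v \<noteq> 0"
    define s where "s = (\<bar>(p - v) \<bullet> \<xi>\<bar> + 1) / (d \<bullet> \<xi>)"
    have "0 \<le> s" using d by (simp add: s_def)
    from term_nonzero_imp_le[OF far[OF this] pI that nz]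
    have "(p - v) \<bullet> \<xi> + s * (d \<bullet> \<xi>) \<le> 0"
      by (simp add: algebra_simps)
    then show False using d by (simp add: s_def)
  qed
  ultimately show ?thesis by (simp add: vertex_sum_def)
qed

text \<open>
  The outer induction descends from \<open>I\<close> to larger sets, that is, to faces of smaller dimension. The
  inner one counts the constraints in \<open>pending\<close>, whose value still differs from the one, called
  \<open>fin\<close>, that it takes far out on the ray from \<open>p\<close> in the direction \<open>d\<close>. One such constraint
  is settled at a time, at the moment when the moving point reaches its hyperplane.
\<close>

theorem vertex_sum_eq_prod:
  assumes pol: "\<And>v h. v \<in> V \<Longrightarrow> h \<in> active v \<Longrightarrow> edge v h \<bullet> \<xi> \<noteq> 0"
  assumes "v0 \<in> V" "I \<subseteq> active v0"
    and "\<And>h. h \<in> I \<Longrightarrow> slack h p = 0" "compatible p c"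
  shows "vertex_sum \<xi> I c = prod c (H - I)"
  using assms(2-)
proof (induction "card H - card I" arbitrary: I v0 p c rule: less_induct)
  case (less I v0)
  have IH: "vertex_sum \<xi> (insert h I) c = prod c (H - insert h I)"
    if "h \<in> H - I" "v \<in> V" "insert h I \<subseteq> active v" "\<And>k. k \<in> insert h I \<Longrightarrow> slack k q = 0" "compatible q c"
    for h v q c
  proof (rule less.hyps[OF _ that(2-5)])
    have "insert h I \<subseteq> H" using that active_sub by blast
    then have "card (insert h I) \<le> card H" "finite I" 
      using finite_H by (simp_all only: card_mono finite_subset[of I H])
         (auto dest: finite_subset)
    then show "card H - card (insert h I) < card H - card I"
      using that(1) by simp
  qed
  have I_sub: "I \<subseteq> H" using less.prems(2) active_sub by auto
  show ?case
  proof (cases "I = active v0")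
    case True
    have only: "v = v0" if "v \<in> V" "I \<subseteq> active v" for v
      using expand[OF less.prems(1), of v] that True by (auto simp: active_def subset_iff)
    have pv: "p = v0"
      using expand[OF less.prems(1), of p] less.prems(3) True by auto
    have W: "{v \<in> V. active v0 \<subseteq> active v} = {v0}" using only less.prems(1) True by blast
    have "c h = 1" if "h \<in> H - I" for h
    proof -
      have "0 \<le> slack h v0" "slack h v0 \<noteq> 0"
        using that V_sub less.prems(1) True by (auto simp: S_slack active_def)
      then show ?thesis using less.prems(4) that pv by (auto simp: compatible_def)
    qed
    then show ?thesis
      using True by (simp add: vertex_sum_def W term_at_def)
  next
    case False
    then obtain k where k: "k \<in> active v0 - I" using less.prems(2) by blast
    \<comment> \<open>Moving along an edge at \<open>v0\<close> that lies in the face keeps the constraints in \<open>I\<close> tight; polarization makes the inner product with \<open>\<xi>\<close> nonzero.\<close>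
    define d where "d = sgn (edge v0 k \<bullet> \<xi>) *\<^sub>R edge v0 k"
    have d: "0 < d \<bullet> \<xi>"
      using pol[OF less.prems(1), of k] k by (auto simp: d_def sgn_if)
    have aI: "a h \<bullet> d = 0" if "h \<in> I" for h
      using orthogonal[OF less.prems(1), of k h] k that less.prems(2) by (auto simp: d_def)
    define fin where "fin h = (if a h \<bullet> d < 0 then 1 else 0 :: real)" for h
    define pending where "pending c = {h\<in>H. a h \<bullet> d \<noteq> 0 \<and> c h \<noteq> fin h}" for c
    have finp: "finite (pending c)" for c using finite_H by (simp add: pending_def)
    from less.prems(3,4) show ?thesis
    proof (induction "card (pending c)" arbitrary: p c rule: less_induct)
      case (less c p)
      note pI = less.prems(1) and comp = less.prems(2)
      have pI': "slack h (p + s *\<^sub>R d) = 0" if "h \<in> I" for s h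
        using pI[OF that] aI[OF that] by (simp add: slack_move)
      show ?case
      proof (cases "pending c = {}")
        case True
        have "compatible (p + s *\<^sub>R d) c" if s: "0 \<le> s" for s
          unfolding compatible_def
        proof
          fix h assume h: "h \<in> H"
          have *: "a h \<bullet> d \<noteq> 0 \<longrightarrow> c h = fin h" using True h by (auto simp: pending_def)
          have **: "0 < slack h p \<longrightarrow> c h = 1" "slack h p < 0 \<longrightarrow> c h = 0"
            using comp h by (auto simp: compatible_def)
          consider "a h \<bullet> d = 0" | "a h \<bullet> d < 0" "s * (a h \<bullet> d) \<le> 0" | "a h \<bullet> d > 0" "0 \<le> s * (a h \<bullet> d)"
            using s by (metis linorder_less_linear mult_nonneg_nonneg mult_nonneg_nonpos less_imp_le)
          then show "(0 < slack h (p + s *\<^sub>R d) \<longrightarrow> c h = 1) \<and> (slack h (p + s *\<^sub>R d) < 0 \<longrightarrow> c h = 0)"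
            using * ** by cases (auto simp: slack_move fin_def)
        qed
        then show ?thesis using sums_vanish_far pI' d by blast
      next
        case False
        \<comment> \<open>The pending constraint that is reached first. Its time is nonnegative: a value that differs from \<open>fin\<close> means that its hyperplane still lies ahead or contains \<open>p\<close>.\<close>
        define time where "time h = slack h p / (a h \<bullet> d)" for h
        define g where "g = arg_min_on time (pending c)"
        have g: "g \<in> pending c" and g_min: "\<And>h. h \<in> pending c \<Longrightarrow> time g \<le> time h"
          using arg_min_if_finite(1)[OF finp False] arg_min_least[OF finp False] by (auto simp: g_def)
        define s where "s = time g"
        define q where "q = p + s *\<^sub>R d"
        have gH: "g \<in> H" "a g \<bullet> d \<noteq> 0" "c g \<noteq> fin g" using g by (auto simp: pending_def)
        have gI: "g \<in> H - I" using gH aI by auto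
        have s0: "0 \<le> s"
          using compatible_nonneg[OF comp gH(1)] compatible_nonpos[OF comp gH(1)] gH
          by (auto simp: s_def time_def fin_def zero_le_divide_iff split: if_splits)
        have gq: "slack g q = 0"
          using gH by (simp add: q_def slack_move s_def time_def)
        have compq: "compatible q c"
          unfolding compatible_def
        proof
          fix h assume h: "h \<in> H"
          have **: "0 < slack h p \<longrightarrow> c h = 1" "slack h p < 0 \<longrightarrow> c h = 0"
            using comp h by (auto simp: compatible_def)
          have drift: "a h \<bullet> d < 0 \<Longrightarrow> s * (a h \<bullet> d) \<le> 0" "a h \<bullet> d > 0 \<Longrightarrow> 0 \<le> s * (a h \<bullet> d)"
              using s0 by (auto intro: mult_nonneg_nonneg mult_nonneg_nonpos)
          consider (stay) "a h \<bullet> d = 0" | (passed) "a h \<bullet> d \<noteq> 0" "c h = fin h" | (pend) "h \<in> pending c"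
            using h by (auto simp: pending_def)
          then show "(0 < slack h q \<longrightarrow> c h = 1) \<and> (slack h q < 0 \<longrightarrow> c h = 0)"
          proof cases
            case stay
            then show ?thesis using ** by (simp add: q_def slack_move)
          next
            case passed
            then show ?thesis
              using passed drift ** by (auto simp: q_def slack_move fin_def)
          next
            case pend
            then have "s \<le> slack h p / (a h \<bullet> d)" "a h \<bullet> d \<noteq> 0"
              using g_min by (auto simp: s_def time_def pending_def)
            then have "a h \<bullet> d > 0 \<Longrightarrow> s * (a h \<bullet> d) \<le> slack h p" "a h \<bullet> d < 0 \<Longrightarrow> slack h p \<le> s * (a h \<bullet> d)"
              by (auto simp: field_simps)
            then show ?thesis
              using pend drift ** by (auto simp: q_def slack_move fin_def pending_def split: if_splits)
          qed
        qed
        have qI: "slack h q = 0" if "h \<in> insert g I" for h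
          using that gq pI' by (auto simp: q_def)
        \<comment> \<open>At \<open>q\<close> the constraint \<open>g\<close> is tight, so its value is free and may be set to \<open>fin g\<close>.\<close>
        define c' where "c' = c(g := fin g)"
        have "compatible q c'"
          using compq gq by (auto simp: compatible_def c'_def)
        moreover have "card (pending c') < card (pending c)"
          using g by (intro psubset_card_mono finp) (auto simp: pending_def c'_def)
        ultimately have c': "vertex_sum \<xi> I c' = prod c' (H - I)"
          using less.hyps[of c' q] qI by auto
        have "vertex_sum \<xi> (insert g I) c = prod c (H - insert g I)"
        proof (cases "\<exists>v\<in>V. insert g I \<subseteq> active v")
          case True
          then show ?thesis using IH[OF gI _ _ qI compq] by blast
        next
          case False
          \<comment> \<open>The hyperplane of \<open>g\<close> misses the face, so \<open>q\<close> lies outside \<open>S\<close> and another constraint is violated.\<close>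
          have "{v \<in> V. insert g I \<subseteq> active v} = {}" using False by blast
          then have "vertex_sum \<xi> (insert g I) c = 0" by (simp only: vertex_sum_def sum.empty)
          moreover have "prod c (H - insert g I) = 0"
          proof (rule ccontr)
            assume "prod c (H - insert g I) \<noteq> 0"
            from vertex_exists[OF prod_nonzero_imp_mem[OF compq qI this]]
            obtain v where "v \<in> V" "active q \<subseteq> active v" by blast
            moreover have "insert g I \<subseteq> active q"
              using qI gI I_sub by (auto simp: active_def)
            ultimately show False using False by blast
          qed
          ultimately show ?thesis by simp
        qed
        then show ?thesis
          using c' vertex_sum_update[OF gI, of \<xi> c "fin g"] prod_update[OF gI, of c "fin g"]
          by (simp add: c'_def)
      qed
    qed
  qed
qed


text \<open>
  The edges at a vertex form a basis, so exactly \<open>DIM('a)\<close> constraints are tight there. This is what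
  makes codimension count tight constraints.
\<close>

lemma independent_edges:
  assumes v: "v \<in> V"
  shows "independent (edge v ` active v)"
proof (rule independent_if_scalars_zero)
  fix f x assume sum: "(\<Sum>x\<in>edge v ` active v. f x *\<^sub>R x) = 0" and x: "x \<in> edge v ` active v"
  then obtain h where h: "h \<in> active v" "x = edge v h" by blast
  have "v - v = (\<Sum>k\<in>active v. f (edge v k) *\<^sub>R edge v k)"
    using sum by (simp add: sum.reindex[OF inj_on_edge[OF v]])
  from expand_unique[OF v this h(1)] show "f x = 0"
    using decreasing[OF v h(1)] h by (auto simp: active_def)
qed (use finite_active in simp)

lemma card_active:
  assumes v: "v \<in> V" shows "card (active v) = DIM('a)"
  using dim_unique[OF _ _ independent_edges[OF v] refl, of UNIV] spanning[OF v]
  by (simp add: card_image inj_on_edge[OF v])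

text \<open>
  Let \<open>v\<close> be a vertex on which all constraints tight at \<open>p\<close> are tight, and let \<open>K\<close> be the set of the other
  constraints tight at \<open>v\<close>. A short step from \<open>p\<close> along \<open>edge v h\<close> with \<open>h\<close> in \<open>K\<close> stays in \<open>S\<close> in
  both directions, so every face containing \<open>p\<close> contains these steps and has dimension at least
  \<open>card K\<close>. The face cut out by the constraints tight at \<open>p\<close> lies in \<open>v\<close> plus the span of these
  edges and attains this bound.
\<close>

lemma least_face_dim:
  assumes p: "p \<in> S"
  shows "(LEAST d. \<exists>F. F face_of S \<and> p \<in> F \<and> aff_dim F = int d) = DIM('a) - card (active p)"
proof -
  obtain v where v: "v \<in> V" "active p \<subseteq> active v" using vertex_exists[OF p] by blast
  define K where "K = active v - active p"
  have KV: "K \<subseteq> active v" by (auto simp: K_def)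
  have card_K: "card K = DIM('a) - card (active p)"
    using card_active[OF v(1)] v(2) finite_active by (simp add: K_def card_Diff_subset)
  have card_EK: "card (edge v ` K) = card K"
    using inj_on_subset[OF inj_on_edge[OF v(1)] KV] by (rule card_image)
  have indep: "independent (edge v ` K)"
    using independent_mono[OF independent_edges[OF v(1)]] KV by blast
  have lower: "int (card K) \<le> aff_dim F" if F: "F face_of S" "p \<in> F" for F
  proof -
    have "\<exists>e>0. p + e *\<^sub>R edge v h \<in> F" if h: "h \<in> K" for h
    proof -
      have z: "a k \<bullet> edge v h = 0" if "k \<in> active p" for k
        using orthogonal[OF v(1), of h k] h that v(2) by (auto simp: K_def)
      obtain e1 where e1: "e1 > 0" "p + e1 *\<^sub>R edge v h \<in> S"
        using small_step[OF finite_H S_eq p, of "edge v h"] z by (auto simp: active_def slack_def)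
      obtain e2 where e2: "e2 > 0" "p + e2 *\<^sub>R (- edge v h) \<in> S"
        using small_step[OF finite_H S_eq p, of "- edge v h"] z by (auto simp: active_def slack_def)
      have nz: "edge v h \<noteq> 0" using decreasing[OF v(1), of h] h KV by auto
      define u where "u = e1 / (e1 + e2)"
      have u: "0 < u" "u < 1" "(1 - u) * e1 = u * e2"
        using e1(1) e2(1) by (auto simp: u_def field_simps)
      have "(1 - u) *\<^sub>R (p + e1 *\<^sub>R edge v h) + u *\<^sub>R (p + e2 *\<^sub>R (- edge v h))
          = p + ((1 - u) * e1 - u * e2) *\<^sub>R edge v h"
        by (simp add: algebra_simps)
      then have "p = (1 - u) *\<^sub>R (p + e1 *\<^sub>R edge v h) + u *\<^sub>R (p + e2 *\<^sub>R (- edge v h))"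
        using u(3) by simp
      moreover have "p + e1 *\<^sub>R edge v h \<noteq> p + e2 *\<^sub>R (- edge v h)"
      proof
        assume "p + e1 *\<^sub>R edge v h = p + e2 *\<^sub>R (- edge v h)"
        then have "(e1 + e2) *\<^sub>R edge v h = 0" by (simp add: algebra_simps add_eq_0_iff)
        then show False using nz e1 e2 by auto
      qed
      ultimately have "p \<in> open_segment (p + e1 *\<^sub>R edge v h) (p + e2 *\<^sub>R (- edge v h))"
        unfolding in_segment using u(1,2) by blast
      then show ?thesis using face_ofD[OF F(1) _ e1(2) e2(2) F(2)] e1 by blast
    qed
    then obtain e where e: "\<And>h. h \<in> K \<Longrightarrow> e h > 0 \<and> p + e h *\<^sub>R edge v h \<in> F" by metis
    have "edge v ` K \<subseteq> span ((\<lambda>x. x - p) ` F)"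
    proof
      fix x assume "x \<in> edge v ` K"
      then obtain h where h: "h \<in> K" "x = edge v h" by blast
      have "(p + e h *\<^sub>R edge v h) - p \<in> span ((\<lambda>x. x - p) ` F)"
        using e[OF h(1)] by (intro span_base) blast
      then have "(1 / e h) *\<^sub>R ((p + e h *\<^sub>R edge v h) - p) \<in> span ((\<lambda>x. x - p) ` F)"
        by (rule span_scale)
      then show "x \<in> span ((\<lambda>x. x - p) ` F)" using e[OF h(1)] h by simp
    qed
    then have "card (edge v ` K) \<le> dim (span ((\<lambda>x. x - p) ` F))"
      using indep by (intro independent_card_le_dim)
    moreover have "aff_dim F = int (dim ((\<lambda>x. x - p) ` F))"
      using aff_dim_zero[of "(\<lambda>x. x - p) ` F"] F(2)
      by (force simp: aff_dim_translation_eq_subtract intro: hull_inc)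
    ultimately show ?thesis by (simp add: card_EK)
  qed
  define G where "G = {x\<in>S. \<forall>h\<in>active p. b h - a h \<bullet> x = 0}"
  have G: "G face_of S" unfolding G_def by (rule face_of_tight_inequalities[OF S_eq active_sub])
  have pG: "p \<in> G" using p by (auto simp: G_def active_def slack_def)
  have upper: "aff_dim G \<le> int (card K)"
  proof -
    have "(\<lambda>x. x - v) ` G \<subseteq> span (edge v ` K)"
    proof clarify
      fix x assume x: "x \<in> G"
      have "x - v = (\<Sum>h\<in>K. (slack h x / - (a h \<bullet> edge v h)) *\<^sub>R edge v h)"
        unfolding expand[OF v(1), of x] K_def using x v(2) finite_active active_sub
        by (intro sum.mono_neutral_right) (auto simp: G_def slack_def)
      also have "\<dots> \<in> span (edge v ` K)"
        by (intro span_sum span_scale span_base) auto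
      finally show "x - v \<in> span (edge v ` K)" .
    qed
    then have "aff_dim ((\<lambda>x. x - v) ` G) \<le> aff_dim (span (edge v ` K))"
      by (rule aff_dim_subset)
    also have "\<dots> = int (dim (edge v ` K))" by (simp add: aff_dim_subspace)
    also have "\<dots> \<le> int (card K)"
      using indep by (simp add: dim_eq_card_independent card_EK)
    finally show ?thesis by (simp add: aff_dim_translation_eq_subtract)
  qed
  show ?thesis
    unfolding card_K[symmetric]
  proof (rule Least_equality)
    show "\<exists>F. F face_of S \<and> p \<in> F \<and> aff_dim F = int (card K)"
      using G pG lower[OF G pG] upper by (intro exI[of _ G]) auto
  qed (use lower in force)
qed

end

section \<open>Bases of the integer lattice\<close>

lemma int_combination_in_lattice:
  assumes "\<And>b. b \<in> B \<Longrightarrow> f b \<in> int_lattice"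
  shows "(\<Sum>b\<in>B. of_int (k b :: int) *\<^sub>R f b) \<in> int_lattice"
  using assms by (auto simp: int_lattice_def intro!: Ints_sum Ints_mult)

text \<open>
  Uniqueness of all integer expansions is equivalent to uniqueness for the vector \<open>0\<close>.
\<close>

lemma int_basis_iff:
  "int_basis B \<longleftrightarrow> finite B \<and> B \<subseteq> int_lattice \<and>
     (\<forall>x\<in>int_lattice. \<exists>k :: real ^ 'n \<Rightarrow> int. x = (\<Sum>b\<in>B. of_int (k b) *\<^sub>R b)) \<and>
     (\<forall>k :: real ^ 'n \<Rightarrow> int. (\<Sum>b\<in>B. of_int (k b) *\<^sub>R b) = 0 \<longrightarrow> (\<forall>b\<in>B. k b = 0))"
  (is "?L \<longleftrightarrow> ?R")
proof
  assume L: ?L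
  have "\<forall>b\<in>B. k b = 0" if k: "(\<Sum>b\<in>B. of_int (k b) *\<^sub>R b) = 0" for k :: "real ^ 'n \<Rightarrow> int"
  proof -
    define k' where "k' b = (if b \<in> B then k b else 0)" for b
    have "0 = (\<Sum>b\<in>B. of_int (k' b) *\<^sub>R b)"
      unfolding k[symmetric] by (rule sum.cong) (auto simp: k'_def)
    moreover have "(0 :: real ^ 'n) \<in> int_lattice" by (simp add: int_lattice_def)
    then have "\<exists>!l :: real ^ 'n \<Rightarrow> int. (\<forall>b. b \<notin> B \<longrightarrow> l b = 0) \<and> 0 = (\<Sum>b\<in>B. of_int (l b) *\<^sub>R b)"
      using L unfolding int_basis_def by blast
    then obtain l0 where l0: "\<And>l :: real ^ 'n \<Rightarrow> int. (\<forall>b. b \<notin> B \<longrightarrow> l b = 0) \<and>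
        0 = (\<Sum>b\<in>B. of_int (l b) *\<^sub>R b) \<Longrightarrow> l = l0"
      by (elim ex1E) blast
    ultimately have "k' = l0" "(\<lambda>_. 0) = l0"
      by (auto intro!: l0 simp: k'_def)
    then have "k' = (\<lambda>_. 0)" by simp
    then show ?thesis by (metis k'_def)
  qed
  moreover have "\<exists>k :: real ^ 'n \<Rightarrow> int. x = (\<Sum>b\<in>B. of_int (k b) *\<^sub>R b)" if "x \<in> int_lattice" for x
    using L that unfolding int_basis_def by (meson ex1_implies_ex)
  ultimately show ?R using L unfolding int_basis_def by simp
next
  assume R: ?R
  then have R1: "\<forall>x\<in>int_lattice. \<exists>k :: real ^ 'n \<Rightarrow> int. x = (\<Sum>b\<in>B. of_int (k b) *\<^sub>R b)"
    and R2: "\<forall>k :: real ^ 'n \<Rightarrow> int. (\<Sum>b\<in>B. of_int (k b) *\<^sub>R b) = 0 \<longrightarrow> (\<forall>b\<in>B. k b = 0)"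
    and R0: "finite B" "B \<subseteq> int_lattice"
    by simp_all
  have "\<exists>!k :: real ^ 'n \<Rightarrow> int. (\<forall>b. b \<notin> B \<longrightarrow> k b = 0) \<and> x = (\<Sum>b\<in>B. of_int (k b) *\<^sub>R b)"
    if x: "x \<in> int_lattice" for x
  proof -
    obtain k :: "real ^ 'n \<Rightarrow> int" where k: "x = (\<Sum>b\<in>B. of_int (k b) *\<^sub>R b)"
      using bspec[OF R1 x] by (elim exE)
    show ?thesis
    proof (rule ex1I[of _ "\<lambda>b. if b \<in> B then k b else 0"])
      fix l :: "real ^ 'n \<Rightarrow> int" assume l: "(\<forall>b. b \<notin> B \<longrightarrow> l b = 0) \<and> x = (\<Sum>b\<in>B. of_int (l b) *\<^sub>R b)"
      have "(\<Sum>b\<in>B. of_int (l b - k b) *\<^sub>R b) = 0"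
        using k l by (simp add: algebra_simps sum_subtractf)
      from R2[THEN spec, THEN mp, OF this] have "\<forall>b\<in>B. l b - k b = 0" .
      then show "l = (\<lambda>b. if b \<in> B then k b else 0)" using l by (auto simp: fun_eq_iff)
    next
      have "x = (\<Sum>b\<in>B. of_int (if b \<in> B then k b else 0) *\<^sub>R b)"
        unfolding k by (rule sum.cong) auto
      then show "(\<forall>b. b \<notin> B \<longrightarrow> (if b \<in> B then k b else 0) = 0) \<and>
          x = (\<Sum>b\<in>B. of_int (if b \<in> B then k b else 0) *\<^sub>R b)" by simp
    qed
  qed
  then show ?L using R0 unfolding int_basis_def by simp
qed

lemma int_basis_zero:
  fixes k :: "real ^ 'n \<Rightarrow> int"
  assumes "int_basis B" "(\<Sum>b\<in>B. of_int (k b) *\<^sub>R b) = 0" "b \<in> B"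
  shows "k b = 0"
  using assms unfolding int_basis_iff by simp

lemma int_basis_unique:
  fixes k l :: "real ^ 'n \<Rightarrow> int" and B :: "(real ^ 'n) set"
  assumes "int_basis B" "(\<Sum>b\<in>B. of_int (k b) *\<^sub>R b) = (\<Sum>b\<in>B. of_int (l b) *\<^sub>R b)" "b \<in> B"
  shows "k b = l b"
proof -
  have "(\<Sum>b\<in>B. of_int (k b - l b) *\<^sub>R b) = 0"
    using assms(2) by (simp add: algebra_simps sum_subtractf)
  from int_basis_zero[OF assms(1) this assms(3)] show ?thesis by simp
qed

lemma int_basis_expand:
  fixes B :: "(real ^ 'n) set"
  assumes "int_basis B" "x \<in> int_lattice"
  obtains k :: "real ^ 'n \<Rightarrow> int" where "x = (\<Sum>b\<in>B. of_int (k b) *\<^sub>R b)"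
  using assms unfolding int_basis_iff by metis

lemma sum_single:
  fixes B :: "(real ^ 'n) set"
  assumes "finite B" "b \<in> B"
  shows "(\<Sum>c\<in>B. of_int (if c = b then m else 0 :: int) *\<^sub>R c) = of_int m *\<^sub>R b"
proof -
  have "(\<Sum>c\<in>B. of_int (if c = b then m else 0 :: int) *\<^sub>R c) = (\<Sum>c\<in>B. if c = b then of_int m *\<^sub>R b else 0)"
    by (rule sum.cong) auto
  then show ?thesis using assms by simp
qed

lemma int_basis_nonzero:
  fixes B :: "(real ^ 'n) set"
  assumes B: "int_basis B" and b: "b \<in> B" shows "b \<noteq> 0"
proof
  assume "b = 0"
  then have "(\<Sum>c\<in>B. of_int (if c = b then 1 else 0 :: int) *\<^sub>R c) = (\<Sum>c\<in>B. of_int (0 :: int) *\<^sub>R c)"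
    by (intro sum.cong) auto
  from int_basis_unique[OF B this b] show False by simp
qed

text \<open>
  The factor \<open>r\<close> is a quotient \<open>q / p\<close> of integers, read off a nonzero component of \<open>b\<close>. Comparing the
  integer expansions of \<open>p * a\<close> and \<open>q * b\<close> shows that only \<open>b\<close> occurs in the expansion of \<open>a\<close>.
\<close>

lemma int_basis_multiple:
  fixes B :: "(real ^ 'n) set"
  assumes B: "int_basis B" and b: "b \<in> B" and a: "a \<in> int_lattice" "a = r *\<^sub>R b"
  obtains m :: int where "a = of_int m *\<^sub>R b"
proof -
  have fin: "finite B" and "b \<in> int_lattice" using B b by (auto simp: int_basis_def)
  obtain i where i: "b $ i \<noteq> 0" using int_basis_nonzero[OF B b] by (auto simp: vec_eq_iff)
  obtain p q where p: "b $ i = of_int p" and q: "a $ i = of_int q"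
    using \<open>b \<in> int_lattice\<close> a(1) unfolding int_lattice_def by (metis Ints_cases mem_Collect_eq)
  obtain k :: "real ^ 'n \<Rightarrow> int" where k: "a = (\<Sum>c\<in>B. of_int (k c) *\<^sub>R c)"
    using int_basis_expand[OF B a(1)] .
  have "of_int p *\<^sub>R a = of_int q *\<^sub>R b"
    unfolding p[symmetric] q[symmetric] a(2) by simp
  then have "(\<Sum>c\<in>B. of_int (p * k c) *\<^sub>R c) = (\<Sum>c\<in>B. of_int (if c = b then q else 0) *\<^sub>R c)"
    unfolding sum_single[OF fin b] k scaleR_sum_right by simp
  from int_basis_unique[OF B this] have "p * k c = (if c = b then q else 0)" if "c \<in> B" for c
    using that by blast
  moreover have "p \<noteq> 0" using i p by auto
  ultimately have "k c = (if c = b then k b else 0)" if "c \<in> B" for c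
    using that by fastforce
  then have "a = (\<Sum>c\<in>B. of_int (if c = b then k b else 0) *\<^sub>R c)"
    unfolding k by (intro sum.cong) auto
  then show ?thesis using that sum_single[OF fin b] by metis
qed

lemma int_basis_line_inj:
  fixes B :: "(real ^ 'n) set"
  assumes B: "int_basis B" and b: "b \<in> B" "b' \<in> B" "b' = r *\<^sub>R b"
  shows "b' = b"
proof (rule ccontr)
  assume ne: "b' \<noteq> b"
  have fin: "finite B" and "b' \<in> int_lattice" using B b by (auto simp: int_basis_def)
  obtain m :: int where m: "b' = of_int m *\<^sub>R b"
    by (rule int_basis_multiple[OF B b(1) \<open>b' \<in> int_lattice\<close> b(3)])
  have "(\<Sum>c\<in>B. of_int (if c = b' then 1 else 0 :: int) *\<^sub>R c) = (\<Sum>c\<in>B. of_int (if c = b then m else 0) *\<^sub>R c)"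
    unfolding sum_single[OF fin b(1)] sum_single[OF fin b(2)] using m by simp
  from int_basis_unique[OF B this b(2)] ne show False by auto
qed

lemma int_basis_primitive:
  fixes B :: "(real ^ 'n) set"
  assumes B: "int_basis B" and b: "b \<in> B"
  shows "primitive_vector b" "primitive_vector (- b)"
proof -
  have fin: "finite B" and bl: "b \<in> int_lattice" using B b by (auto simp: int_basis_def)
  have "\<bar>k\<bar> = 1" if c: "c \<in> int_lattice" "of_int s *\<^sub>R b = of_int k *\<^sub>R c" "\<bar>s\<bar> = 1" for s k :: int and c
  proof -
    obtain l :: "real ^ 'n \<Rightarrow> int" where l: "c = (\<Sum>d\<in>B. of_int (l d) *\<^sub>R d)"
      using int_basis_expand[OF B c(1)] .
    have "(\<Sum>d\<in>B. of_int (if d = b then s else 0) *\<^sub>R d) = (\<Sum>d\<in>B. of_int (k * l d) *\<^sub>R d)"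
      unfolding sum_single[OF fin b] c(2) l by (simp add: scaleR_sum_right)
    from int_basis_unique[OF B this b] have "s = k * l b" by simp
    then have "\<bar>k\<bar> * \<bar>l b\<bar> = 1" using c(3) by (simp add: abs_mult)
    then have "\<bar>k\<bar> dvd 1" by (metis dvd_triv_left)
    then show ?thesis by simp
  qed
  then have "\<bar>k\<bar> = 1" if "c \<in> int_lattice" "b = of_int k *\<^sub>R c \<or> - b = of_int k *\<^sub>R c" for k :: int and c
    using that by (metis abs_minus_cancel abs_one of_int_1 of_int_minus scaleR_one scaleR_minus1_left)
  moreover have "- b \<in> int_lattice" using bl by (simp add: int_lattice_def)
  ultimately show "primitive_vector b" "primitive_vector (- b)"
    using bl int_basis_nonzero[OF B b] unfolding primitive_vector_def by auto
qed

lemma primitive_multiple: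
  fixes B :: "(real ^ 'n) set"
  assumes B: "int_basis B" and b: "b \<in> B" and a: "primitive_vector a" "a = r *\<^sub>R b"
  shows "a = b \<or> a = - b"
proof -
  have "a \<in> int_lattice" using a(1) by (simp add: primitive_vector_def)
  have "b \<in> int_lattice" using B b by (auto simp: int_basis_def)
  obtain m :: int where m: "a = of_int m *\<^sub>R b"
    by (rule int_basis_multiple[OF B b \<open>a \<in> int_lattice\<close> a(2)])
  then have "\<bar>m\<bar> = 1" using a(1) \<open>b \<in> int_lattice\<close> unfolding primitive_vector_def by blast
  then have "m = 1 \<or> m = -1" by linarith
  then show ?thesis using m by auto
qed

text \<open>
  The lines along the edges determine the edge vectors only up to sign.
\<close>

lemma int_basis_flip:
  fixes B :: "(real ^ 'n) set"
  assumes B: "int_basis B" and f: "\<And>b. b \<in> B \<Longrightarrow> f b = b \<or> f b = - b"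
  shows "int_basis (f ` B)" and "inj_on f B"
proof -
  define s :: "real ^ 'n \<Rightarrow> int" where "s b = (if f b = b then 1 else -1)" for b
  have fs: "f b = of_int (s b) *\<^sub>R b" "s b * s b = 1" if "b \<in> B" for b
    using f[OF that] by (auto simp: s_def)
  show inj: "inj_on f B"
  proof (rule inj_onI)
    fix x y assume xy: "x \<in> B" "y \<in> B" "f x = f y"
    then have "y = 1 *\<^sub>R x \<or> y = (-1) *\<^sub>R x" using f[of x] f[of y] by (auto simp: minus_equation_iff)
    then show "x = y" using int_basis_line_inj[OF B xy(1,2)] by metis
  qed
  have sum: "(\<Sum>c\<in>f ` B. of_int (k c) *\<^sub>R c) = (\<Sum>b\<in>B. of_int (k (f b) * s b) *\<^sub>R b)" for k :: "real ^ 'n \<Rightarrow> int"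
    unfolding sum.reindex[OF inj] o_def by (intro sum.cong refl) (subst (2) fs(1), auto)
  show "int_basis (f ` B)"
    unfolding int_basis_iff
  proof (intro conjI ballI allI impI)
    show "finite (f ` B)" using B by (simp add: int_basis_def)
    show "f ` B \<subseteq> int_lattice"
    proof clarify
      fix b assume "b \<in> B"
      then have "b \<in> int_lattice" using B by (auto simp: int_basis_def)
      then show "f b \<in> int_lattice" using f[OF \<open>b \<in> B\<close>] by (auto simp: int_lattice_def)
    qed
    fix x :: "real ^ 'n" assume "x \<in> int_lattice"
    then obtain k :: "real ^ 'n \<Rightarrow> int" where k: "x = (\<Sum>b\<in>B. of_int (k b) *\<^sub>R b)"
      using int_basis_expand[OF B] by blast
    define k' where "k' c = k (inv_into B f c) * s (inv_into B f c)" for c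
    have "x = (\<Sum>c\<in>f ` B. of_int (k' c) *\<^sub>R c)"
      unfolding sum k using fs(2) by (intro sum.cong refl) (simp add: k'_def inj mult.assoc)
    then show "\<exists>k :: real ^ 'n \<Rightarrow> int. x = (\<Sum>b\<in>f ` B. of_int (k b) *\<^sub>R b)" by blast
  next
    fix k :: "real ^ 'n \<Rightarrow> int" and c assume "(\<Sum>b\<in>f ` B. of_int (k b) *\<^sub>R b) = 0" "c \<in> f ` B"
    then obtain b where b: "b \<in> B" "c = f b" "(\<Sum>b\<in>B. of_int (k (f b) * s b) *\<^sub>R b) = 0"
      unfolding sum by blast
    from int_basis_zero[OF B b(3,1)] have "k (f b) * s b = 0" .
    then show "k c = 0" using fs(2)[OF b(1)] b(2) by auto
  qed
qed

lemma span_int_basis: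
  fixes B :: "(real ^ 'n) set"
  assumes B: "int_basis B" shows "span B = UNIV"
proof -
  have "x \<in> span B" if "x \<in> Basis" for x :: "real ^ 'n"
  proof -
    have "x \<in> int_lattice" using that by (auto simp: Basis_vec_def int_lattice_def axis_def)
    then obtain k :: "real ^ 'n \<Rightarrow> int" where "x = (\<Sum>b\<in>B. of_int (k b) *\<^sub>R b)"
      using int_basis_expand[OF B] by blast
    then show ?thesis by (simp add: span_sum span_scale span_base)
  qed
  then have "span Basis \<subseteq> span B" by (intro span_minimal) auto
  then show ?thesis by auto
qed

section \<open>Edges and the cone they span at a vertex\<close>

lemma other_vertex_on_edge:
  assumes S: "compact S" "convex S" and e: "e \<in> edges_at S v"
  obtains w where "w \<in> vertices S" "w \<in> e" "w \<noteq> v"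
proof -
  have eS: "e face_of S" "aff_dim e = 1" "v \<in> e" using e by (auto simp: edges_at_def edge_of_def)
  have ec: "compact e" "convex e"
    using eS(1) S face_of_imp_compact face_of_imp_convex by blast+
  have "\<not> {x. x extreme_point_of e} \<subseteq> {v}"
  proof
    assume "{x. x extreme_point_of e} \<subseteq> {v}"
    then have "e \<subseteq> convex hull {v}"
      using Krein_Milman_Minkowski[OF ec] by (metis hull_mono)
    then have "e = {v}" using eS(3) by auto
    then show False using eS(2) by simp
  qed
  then show ?thesis
    using that extreme_point_of_face[OF eS(1)] by (auto simp: vertices_def)
qed

text \<open>
  The bound on \<open>card B\<close> is where simplicity enters: an integer basis spans the space over the reals,
  and with at most \<open>n\<close> elements it must be linearly independent. Distinct elements of \<open>B\<close> give
  distinct lines, hence \<open>B\<close> has no more elements than there are edges.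
\<close>

lemma regular_basis:
  fixes S :: "(real ^ 'n) set"
  assumes "regular_polytope S" "v \<in> vertices S"
  obtains B where "int_basis B" "card B \<le> CARD('n)"
    and "(\<lambda>e. affine hull e) ` edges_at S v = (\<lambda>b. range (\<lambda>t::real. v + t *\<^sub>R b)) ` B"
proof -
  obtain B where B: "int_basis B"
    "(\<lambda>e. affine hull e) ` edges_at S v = (\<lambda>b. range (\<lambda>t::real. v + t *\<^sub>R b)) ` B"
    using assms unfolding regular_polytope_def by blast
  have ed: "finite (edges_at S v)" "card (edges_at S v) = CARD('n)"
    using assms unfolding regular_polytope_def simple_polytope_def by blast+
  have "inj_on (\<lambda>b. range (\<lambda>t::real. v + t *\<^sub>R b)) B"
  proof (rule inj_onI)
    fix b c assume bc: "b \<in> B" "c \<in> B" "range (\<lambda>t::real. v + t *\<^sub>R b) = range (\<lambda>t::real. v + t *\<^sub>R c)"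
    have "v + 1 *\<^sub>R b \<in> range (\<lambda>t::real. v + t *\<^sub>R b)" by (rule rangeI)
    then have "\<exists>t. b = t *\<^sub>R c" unfolding bc(3) by auto
    then obtain t where "b = t *\<^sub>R c" ..
    then show "b = c" using int_basis_line_inj[OF B(1) bc(2,1)] by blast
  qed
  then have "card B = card ((\<lambda>e. affine hull e) ` edges_at S v)"
    unfolding B(2) by (simp add: card_image)
  also have "\<dots> \<le> CARD('n)" using card_image_le[OF ed(1)] ed(2) by metis
  finally show ?thesis using that B by blast
qed

lemma full_polytopeD:
  fixes S :: "(real ^ 'n) set"
  assumes "regular_polytope S"
  shows "compact S" "convex S" "polyhedron S" "affine hull S = UNIV"
  using assms aff_dim_eq_full[of S]
  unfolding regular_polytope_def simple_polytope_def full_polytope_def by simp_all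

text \<open>
  A vertex other than \<open>v\<close> on an edge tells which of \<open>b\<close> and \<open>- b\<close> is the edge vector.
\<close>

lemma edge_direction:
  assumes S: "regular_polytope S" and v: "v \<in> vertices S"
    and B: "int_basis B" "(\<lambda>e. affine hull e) ` edges_at S v = (\<lambda>b. range (\<lambda>t::real. v + t *\<^sub>R b)) ` B"
    and e: "e \<in> edges_at S v" and w: "w \<in> vertices S" "w \<in> e" "w \<noteq> v"
    and b: "b \<in> B" "affine hull e = range (\<lambda>t::real. v + t *\<^sub>R b)"
  obtains a t where "a \<in> edge_vectors S v" "a = b \<or> a = - b" "t > 0" "w = v + t *\<^sub>R a"
proof -
  have "w \<in> affine hull e" using w(2) by (rule hull_inc)
  then obtain t where t: "w = v + t *\<^sub>R b" using b(2) by auto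
  then have "t \<noteq> 0" using w(3) by auto
  define a where "a = (if t > 0 then b else - b)"
  have wa: "w = v + \<bar>t\<bar> *\<^sub>R a" "\<bar>t\<bar> > 0" using t \<open>t \<noteq> 0\<close> by (auto simp: a_def)
  moreover have "primitive_vector a" using int_basis_primitive[OF B(1) b(1)] by (simp add: a_def)
  ultimately have "a \<in> edge_vectors S v" using e w unfolding edge_vectors_def by blast
  moreover have "a = b \<or> a = - b" by (simp add: a_def)
  ultimately show ?thesis using that wa by blast
qed

lemma edge_vector_step:
  assumes "a \<in> edge_vectors S v"
  obtains t where "t > 0" "v + t *\<^sub>R a \<in> S"
  using assms unfolding edge_vectors_def vertices_def extreme_point_of_def by blast

lemma not_opposite_steps:
  assumes v: "v \<in> vertices S" and a: "a \<noteq> 0" and t: "t > 0" "v + t *\<^sub>R a \<in> S" and s: "s > 0"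
  shows "v - s *\<^sub>R a \<notin> S"
proof
  assume s': "v - s *\<^sub>R a \<in> S"
  define u where "u = t / (t + s)"
  have u: "0 < u" "u < 1" "(1 - u) * t = u * s" using t s by (auto simp: u_def field_simps)
  have "(1 - u) *\<^sub>R (v + t *\<^sub>R a) + u *\<^sub>R (v - s *\<^sub>R a) = v + ((1 - u) * t - u * s) *\<^sub>R a"
    by (simp add: algebra_simps)
  then have "v = (1 - u) *\<^sub>R (v + t *\<^sub>R a) + u *\<^sub>R (v - s *\<^sub>R a)" using u(3) by simp
  moreover have "v + t *\<^sub>R a \<noteq> v - s *\<^sub>R a"
  proof
    assume "v + t *\<^sub>R a = v - s *\<^sub>R a"
    then have "(t + s) *\<^sub>R a = 0" by (simp add: algebra_simps add_eq_0_iff)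
    then show False using a t s by auto
  qed
  ultimately have "v \<in> open_segment (v + t *\<^sub>R a) (v - s *\<^sub>R a)"
    unfolding in_segment using u by blast
  then show False using v t s' unfolding vertices_def extreme_point_of_def by blast
qed

lemma edge_vectors_basis:
  fixes S :: "(real ^ 'n) set"
  assumes S: "regular_polytope S" and v: "v \<in> vertices S"
  shows "int_basis (edge_vectors S v)" "independent (edge_vectors S v)"
proof -
  obtain B where B: "int_basis B" "card B \<le> CARD('n)"
    "(\<lambda>e. affine hull e) ` edges_at S v = (\<lambda>b. range (\<lambda>t::real. v + t *\<^sub>R b)) ` B"
    by (rule regular_basis[OF S v])
  have ex: "\<exists>a\<in>edge_vectors S v. a = b \<or> a = - b" if b: "b \<in> B" for b
  proof -
    obtain e where e: "e \<in> edges_at S v" "affine hull e = range (\<lambda>t::real. v + t *\<^sub>R b)"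
      using B(3) b by (metis (no_types, lifting) imageE imageI)
    obtain w where w: "w \<in> vertices S" "w \<in> e" "w \<noteq> v"
      by (rule other_vertex_on_edge[OF full_polytopeD(1,2)[OF S] e(1)])
    show ?thesis using edge_direction[OF S v B(1,3) e(1) w b e(2)] by metis
  qed
  have all: "\<exists>b\<in>B. a = b \<or> a = - b" if a: "a \<in> edge_vectors S v" for a
  proof -
    obtain e t where et: "primitive_vector a" "e \<in> edges_at S v" "t > 0" "v + t *\<^sub>R a \<in> e"
      using a unfolding edge_vectors_def by blast
    obtain b where b: "b \<in> B" "affine hull e = range (\<lambda>t::real. v + t *\<^sub>R b)"
      using B(3) et(2) by (metis (no_types, lifting) imageE imageI)
    have "v + t *\<^sub>R a \<in> affine hull e" using et(4) by (rule hull_inc)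
    then have "\<exists>r. t *\<^sub>R a = r *\<^sub>R b" using b(2) by auto
    then obtain r where "t *\<^sub>R a = r *\<^sub>R b" ..
    then have "(1 / t) *\<^sub>R (t *\<^sub>R a) = (r / t) *\<^sub>R b" by simp
    then have "a = (r / t) *\<^sub>R b" using et(3) by simp
    then show ?thesis using primitive_multiple[OF B(1) b(1) et(1)] b(1) by blast
  qed
  have one: "c = b" if c: "c \<in> edge_vectors S v" "b \<in> edge_vectors S v" "c = b \<or> c = - b" for b c
  proof (rule ccontr)
    assume "c \<noteq> b"
    then have cb: "c = - b" using c(3) by blast
    obtain t where t: "t > 0" "v + t *\<^sub>R b \<in> S" using c(2) by (rule edge_vector_step)
    obtain s where "s > 0" "v + s *\<^sub>R c \<in> S" using c(1) by (rule edge_vector_step)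
    moreover have "b \<noteq> 0" using c(2) by (auto simp: edge_vectors_def primitive_vector_def)
    ultimately show False using not_opposite_steps[OF v _ t] cb by auto
  qed
  define f where "f b = (SOME a. a \<in> edge_vectors S v \<and> (a = b \<or> a = - b))" for b
  have f: "f b \<in> edge_vectors S v" "f b = b \<or> f b = - b" if "b \<in> B" for b
    using someI_ex[of "\<lambda>a. a \<in> edge_vectors S v \<and> (a = b \<or> a = - b)"] ex[OF that]
    unfolding f_def by blast+
  have E: "f ` B = edge_vectors S v"
  proof
    show "f ` B \<subseteq> edge_vectors S v" using f by blast
    show "edge_vectors S v \<subseteq> f ` B"
    proof
      fix a assume a: "a \<in> edge_vectors S v"
      then obtain b where b: "b \<in> B" "a = b \<or> a = - b" using all by blast
      then have "a = f b \<or> a = - f b" using f(2)[OF b(1)] by auto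
      then have "a = f b" using one[OF a f(1)[OF b(1)]] by blast
      then show "a \<in> f ` B" using b(1) by blast
    qed
  qed
  show I: "int_basis (edge_vectors S v)"
    using int_basis_flip(1)[OF B(1), of f] f(2) unfolding E by blast
  have "card (edge_vectors S v) \<le> CARD('n)"
    unfolding E[symmetric] using card_image_le[of B f] B(1,2) by (auto simp: int_basis_def)
  then show "independent (edge_vectors S v)"
    using span_int_basis[OF I] I
    by (intro card_le_dim_spanning[of _ UNIV]) (auto simp: int_basis_def)
qed

lemma representation_nonneg_convex:
  assumes E: "independent E" "span E = UNIV"
  shows "convex {x. \<forall>a\<in>E. 0 \<le> representation E x a}"
  unfolding convex_alt using E
  by (auto simp: representation_add representation_scale intro!: add_nonneg_nonneg mult_nonneg_nonneg)

text \<open>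
  A polytope lies in the cone spanned by its edges at a vertex \<open>v\<close>. Choose a linear form \<open>f\<close> that is
  positive on \<open>x - v\<close> for all other points \<open>x\<close> of \<open>S\<close>, and project the other vertices radially from
  \<open>v\<close> to the hyperplane \<open>f = 1\<close> (\<open>nrm\<close>). The convex hull \<open>Q\<close> of the projections is a cross-section
  of the cone of \<open>S\<close> at \<open>v\<close>. The ray through an extreme point of \<open>Q\<close> is a face of that cone, and it
  contains the vertex that was projected there, so it meets \<open>S\<close> in an edge. Thus the extreme points of
  \<open>Q\<close> are positive multiples of edge vectors, and by Krein-Milman all of \<open>Q\<close> lies in the cone \<open>C\<close>
  that they span.
\<close>

lemma polytope_in_cone_of_edges:
  fixes S :: "(real ^ 'n) set"
  assumes S: "regular_polytope S" and v: "v \<in> vertices S"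
    and x: "x \<in> S" and a: "a \<in> edge_vectors S v"
  shows "0 \<le> representation (edge_vectors S v) (x - v) a"
proof -
  define E where "E = edge_vectors S v"
  have E: "independent E" "span E = UNIV"
    using edge_vectors_basis[OF S v] span_int_basis by (auto simp: E_def)
  define C where "C = {x. \<forall>a\<in>E. 0 \<le> representation E x a}"
  have convC: "convex C" unfolding C_def by (rule representation_nonneg_convex[OF E])
  have scaleC: "r *\<^sub>R x \<in> C" if "0 \<le> r" "x \<in> C" for r x
    using that E by (auto simp: C_def representation_scale)
  have EC: "a \<in> C" if "a \<in> E" for a
    using that E(1) by (auto simp: C_def representation_basis)
  obtain B where B: "int_basis B" "card B \<le> CARD('n)"
    "(\<lambda>e. affine hull e) ` edges_at S v = (\<lambda>b. range (\<lambda>t::real. v + t *\<^sub>R b)) ` B"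
    by (rule regular_basis[OF S v])
  have vS: "v \<in> S" using v by (auto simp: vertices_def extreme_point_of_def)
  have "{v} exposed_face_of S"
    using v by (simp add: exposed_face_of_polyhedron[OF full_polytopeD(3)[OF S]] face_of_singleton vertices_def)
  then obtain g \<beta> where g: "S \<subseteq> {x. g \<bullet> x \<le> \<beta>}" "{v} = S \<inter> {x. g \<bullet> x = \<beta>}"
    unfolding exposed_face_of_def by blast
  define f where "f x = - (g \<bullet> x)" for x
  have f_scale: "f (r *\<^sub>R x) = r * f x" for r x by (simp add: f_def)
  have f_pos: "0 < f (x - v)" if "x \<in> S" "x \<noteq> v" for x
  proof -
    have "g \<bullet> v = \<beta>" "g \<bullet> x \<noteq> \<beta>" "g \<bullet> x \<le> \<beta>" using g that by auto
    then show ?thesis by (simp add: f_def inner_diff_right)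
  qed
  define nrm where "nrm x = (1 / f (x - v)) *\<^sub>R (x - v)" for x
  define W where "W = vertices S - {v}"
  have finV: "finite (vertices S)"
    using finite_polyhedron_extreme_points[OF full_polytopeD(3)[OF S]] by (simp add: vertices_def)
  have WS: "w \<in> S" "w \<noteq> v" if "w \<in> W" for w
    using that by (auto simp: W_def vertices_def extreme_point_of_def)
  define Q where "Q = convex hull (nrm ` W)"
  have nrmQ: "nrm x \<in> Q" if x: "x \<in> S" "x \<noteq> v" for x
  proof -
    have "x \<in> convex hull vertices S"
      using Krein_Milman_Minkowski[OF full_polytopeD(1,2)[OF S]] x by (simp add: vertices_def)
    then obtain u where u: "\<forall>w\<in>vertices S. 0 \<le> u w" "sum u (vertices S) = 1"
        "(\<Sum>w\<in>vertices S. u w *\<^sub>R w) = x"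
      unfolding convex_hull_finite[OF finV] by blast
    have xv: "x - v = (\<Sum>w\<in>vertices S. u w *\<^sub>R (w - v))"
      using u(2,3) by (simp add: scaleR_diff_right sum_subtractf flip: scaleR_sum_left)
    also have "\<dots> = (\<Sum>w\<in>W. u w *\<^sub>R (w - v))"
      using v finV by (intro sum.mono_neutral_right) (auto simp: W_def)
    finally have xW: "x - v = (\<Sum>w\<in>W. u w *\<^sub>R (w - v))" .
    have fx: "f (x - v) = (\<Sum>w\<in>W. u w * f (w - v))"
      unfolding xW by (simp add: f_def inner_sum_right sum_negf)
    have "nrm x = (\<Sum>w\<in>W. (u w * f (w - v) / f (x - v)) *\<^sub>R nrm w)"
    proof -
      have "nrm x = (\<Sum>w\<in>W. (1 / f (x - v)) *\<^sub>R (u w *\<^sub>R (w - v)))"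
        unfolding nrm_def scaleR_sum_right[symmetric] xW[symmetric] ..
      also have "\<dots> = (\<Sum>w\<in>W. (u w * f (w - v) / f (x - v)) *\<^sub>R nrm w)"
      proof (intro sum.cong refl)
        fix w assume "w \<in> W"
        then have "f (w - v) \<noteq> 0" using f_pos[OF WS] by force
        then show "(1 / f (x - v)) *\<^sub>R (u w *\<^sub>R (w - v)) = (u w * f (w - v) / f (x - v)) *\<^sub>R nrm w"
          by (simp add: nrm_def)
      qed
      finally show ?thesis .
    qed
    moreover have "(\<Sum>w\<in>W. u w * f (w - v) / f (x - v)) = 1"
      using f_pos[OF x] by (simp add: fx flip: sum_divide_distrib)
    moreover have "0 \<le> u w * f (w - v) / f (x - v)" if "w \<in> W" for w
      using that u(1) f_pos[OF WS[OF that]] f_pos[OF x] by (auto simp: W_def)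
    moreover have "finite W" using finV by (simp add: W_def)
    moreover have "nrm w \<in> Q" if "w \<in> W" for w
      unfolding Q_def using that by (intro hull_inc imageI)
    ultimately show ?thesis
      using convex_sum[of W Q "\<lambda>w. u w * f (w - v) / f (x - v)" nrm] convex_convex_hull
      by (simp add: Q_def)
  qed
  have Qf: "f q = 1" if "q \<in> Q" for q
  proof -
    have "convex {q. f q = 1}"
      using convex_hyperplane[of g "-1"] by (simp add: f_def minus_equation_iff[of _ 1] eq_commute)
    moreover have "nrm ` W \<subseteq> {q. f q = 1}"
    proof clarify
      fix w assume "w \<in> W"
      then have "f (w - v) > 0" using f_pos WS by blast
      then show "f (nrm w) = 1" unfolding nrm_def f_scale by simp
    qed
    ultimately have "Q \<subseteq> {q. f q = 1}" unfolding Q_def by (rule hull_minimal[rotated])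
    then show ?thesis using that by blast
  qed
  have ext: "q \<in> C" if q: "q extreme_point_of Q" for q
  proof -
    have qQ: "q \<in> Q" using q by (simp add: extreme_point_of_def)
    have "q \<in> nrm ` W" using q unfolding Q_def by (rule extreme_point_of_convex_hull)
    then obtain w where w: "w \<in> W" "q = nrm w" by blast
    have fw: "f (w - v) > 0" using f_pos WS[OF w(1)] by blast
    have wq: "w = v + f (w - v) *\<^sub>R q" using fw by (simp add: w(2) nrm_def)
    define e where "e = {x\<in>S. \<exists>s\<ge>0. x = v + s *\<^sub>R q}"
    have on_ray: "x \<in> e" if "x \<in> S" "x = v \<or> nrm x = q" for x
    proof (cases "x = v")
      case False
      then have "x = v + f (x - v) *\<^sub>R q" "0 \<le> f (x - v)"
        using that f_pos[of x] by (auto simp: nrm_def)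
      then show ?thesis using that unfolding e_def by blast
    qed (use that in \<open>auto simp: e_def intro: exI[of _ 0]\<close>)
    \<comment> \<open>If a point of the ray lies between \<open>x\<close> and \<open>y\<close>, then \<open>q\<close> lies between their projections; \<open>q\<close> being extreme, both projections are \<open>q\<close>.\<close>
    have face: "e face_of S"
      unfolding face_of_def
    proof (intro conjI ballI impI)
      show "e \<subseteq> S" by (auto simp: e_def)
      show "convex e"
        unfolding convex_alt
      proof (intro ballI allI impI)
        fix x y and u :: real assume xy: "x \<in> e" "y \<in> e" and u: "0 \<le> u \<and> u \<le> 1"
        then obtain s t where st: "0 \<le> s" "x = v + s *\<^sub>R q" "0 \<le> t" "y = v + t *\<^sub>R q"
          by (auto simp: e_def)
        have "(1 - u) *\<^sub>R x + u *\<^sub>R y \<in> S"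
          using full_polytopeD(2)[OF S] xy u unfolding convex_alt e_def by blast
        moreover have "(1 - u) *\<^sub>R x + u *\<^sub>R y = v + ((1 - u) * s + u * t) *\<^sub>R q"
          by (simp add: st algebra_simps)
        moreover have "0 \<le> (1 - u) * s + u * t" using st u by simp
        ultimately show "(1 - u) *\<^sub>R x + u *\<^sub>R y \<in> e" unfolding e_def by blast
      qed
      fix x y z assume xy: "x \<in> S" "y \<in> S" and z: "z \<in> e" "z \<in> open_segment x y"
      then obtain u s where u: "0 < u" "u < 1" "z = (1 - u) *\<^sub>R x + u *\<^sub>R y" "x \<noteq> y"
        and s: "0 \<le> s" "z = v + s *\<^sub>R q"
        by (auto simp: in_segment e_def)
      have comb: "s *\<^sub>R q = (1 - u) *\<^sub>R (x - v) + u *\<^sub>R (y - v)"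
        using u(3) s(2) by (simp add: algebra_simps)
      have nf: "x - v = f (x - v) *\<^sub>R nrm x" if "x \<in> S" for x
        using f_pos[OF that] by (cases "x = v") (auto simp: nrm_def)
      have f0: "0 \<le> f (x - v)" if "x \<in> S" for x
        using f_pos[OF that] by (cases "x = v") (auto simp: f_def)
      have "(x = v \<or> nrm x = q) \<and> (y = v \<or> nrm y = q)"
      proof -
        define \<sigma> \<tau> where "\<sigma> = (1 - u) * f (x - v)" and "\<tau> = u * f (y - v)"
        have pos: "x \<noteq> v \<Longrightarrow> \<sigma> > 0" "y \<noteq> v \<Longrightarrow> \<tau> > 0"
          using f_pos xy u by (auto simp: \<sigma>_def \<tau>_def)
        have s_eq: "s = \<sigma> + \<tau>"
        proof -
          have "s = f (s *\<^sub>R q)" using Qf[OF qQ] by (simp add: f_def)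
          also have "\<dots> = \<sigma> + \<tau>"
            unfolding comb \<sigma>_def \<tau>_def by (simp add: f_def inner_add_right)
          finally show ?thesis .
        qed
        have sq: "s *\<^sub>R q = \<sigma> *\<^sub>R nrm x + \<tau> *\<^sub>R nrm y"
          unfolding comb \<sigma>_def \<tau>_def using nf[OF xy(1)] nf[OF xy(2)] by (metis scaleR_scaleR)
        consider "x = v" "y \<noteq> v" | "y = v" "x \<noteq> v" | "x \<noteq> v" "y \<noteq> v" using u(4) by blast
        then show ?thesis
        proof cases
          case 1
          then have "\<sigma> = 0" by (simp add: \<sigma>_def f_def)
          then show ?thesis using 1 sq s_eq pos by auto
        next
          case 2
          then have "\<tau> = 0" by (simp add: \<tau>_def f_def)
          then show ?thesis using 2 sq s_eq pos by auto
        next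
          case 3
          define \<theta> where "\<theta> = \<tau> / s"
          have \<theta>: "0 < \<theta>" "\<theta> < 1" "1 - \<theta> = \<sigma> / s" "s > 0"
            using pos(1)[OF 3(1)] pos(2)[OF 3(2)] by (auto simp: \<theta>_def s_eq field_simps)
          have "q = (1 / s) *\<^sub>R (s *\<^sub>R q)" using \<theta>(4) by simp
          also have "\<dots> = (1 - \<theta>) *\<^sub>R nrm x + \<theta> *\<^sub>R nrm y"
            unfolding sq \<theta>(3) by (simp add: \<theta>_def scaleR_add_right)
          finally have qc: "q = (1 - \<theta>) *\<^sub>R nrm x + \<theta> *\<^sub>R nrm y" .
          have "q \<notin> open_segment (nrm x) (nrm y)"
            using q nrmQ xy 3 unfolding extreme_point_of_def by blast
          then have "nrm x = nrm y" unfolding in_segment using qc \<theta> by blast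
          moreover from this have "q = nrm x" using qc by (simp add: algebra_simps)
          ultimately show ?thesis by simp
        qed
      qed
      then show "x \<in> e" "y \<in> e" using on_ray xy by blast+
    qed
    have ve: "v \<in> e" using on_ray vS by blast
    have we: "w \<in> e" using on_ray WS[OF w(1)] w(2) by blast
    have "aff_dim e = 1"
    proof (rule antisym)
      have "collinear e"
        unfolding collinear_def
      proof (intro exI[of _ q] ballI)
        fix x y assume "x \<in> e" "y \<in> e"
        then obtain s t where "x = v + s *\<^sub>R q" "y = v + t *\<^sub>R q" by (auto simp: e_def)
        then have "x - y = (s - t) *\<^sub>R q" by (simp add: algebra_simps)
        then show "\<exists>c. x - y = c *\<^sub>R q" ..
      qed
      then show "aff_dim e \<le> 1" by (simp add: collinear_aff_dim)
      have "aff_dim {v, w} \<le> aff_dim e" using ve we by (intro aff_dim_subset) auto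
      then show "1 \<le> aff_dim e" using WS(2)[OF w(1)] by (simp add: aff_dim_2)
    qed
    then have e: "e \<in> edges_at S v" using face ve by (simp add: edges_at_def edge_of_def)
    then obtain b where b: "b \<in> B" "affine hull e = range (\<lambda>t::real. v + t *\<^sub>R b)"
      using B(3) by (metis (no_types, lifting) imageE imageI)
    have "w \<in> vertices S" using w(1) by (simp add: W_def)
    then obtain a t where at: "a \<in> edge_vectors S v" "t > 0" "w = v + t *\<^sub>R a"
      using edge_direction[OF S v B(1,3) e _ we WS(2)[OF w(1)] b] by metis
    have "q = (t / f (w - v)) *\<^sub>R a" using w(2) at(3) by (simp add: nrm_def)
    then show ?thesis using scaleC[of "t / f (w - v)" a] EC at fw by (simp add: E_def)
  qed
  have "compact Q" "convex Q"
    unfolding Q_def using finV by (auto intro!: finite_imp_compact_convex_hull simp: W_def)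
  then have "Q = convex hull {q. q extreme_point_of Q}" by (rule Krein_Milman_Minkowski)
  also have "\<dots> \<subseteq> C" using ext convC by (intro hull_minimal) auto
  finally have QC: "Q \<subseteq> C" .
  have "x - v \<in> C"
  proof (cases "x = v")
    case True
    then show ?thesis by (simp add: C_def representation_zero)
  next
    case False
    then have "x - v = f (x - v) *\<^sub>R nrm x" using f_pos[OF x] by (simp add: nrm_def)
    then show ?thesis
      using scaleC[of "f (x - v)" "nrm x"] f_pos[OF x False] nrmQ[OF x False] QC by auto
  qed
  then show ?thesis using a by (simp add: C_def E_def)
qed

section \<open>The facet inequalities of a regular polytope\<close>

lemma tight_normal_nonpos:
  assumes S: "S = {x. \<forall>h\<in>H. 0 \<le> b h - a h \<bullet> x}"
    and h: "h \<in> tight H a b v" and e: "e \<in> edge_vectors S v"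
  shows "a h \<bullet> e \<le> 0"
proof -
  obtain t where t: "t > 0" "v + t *\<^sub>R e \<in> S" using e by (rule edge_vector_step)
  have "0 \<le> b h - a h \<bullet> (v + t *\<^sub>R e)" "b h - a h \<bullet> v = 0"
    using h t(2) unfolding S tight_def by auto
  then have "t * (a h \<bullet> e) \<le> 0" by (simp add: inner_add_right)
  then show ?thesis using t(1) by (simp add: mult_le_0_iff)
qed

lemma inner_via_representation:
  fixes E :: "(real ^ 'n) set"
  assumes "independent E" "span E = UNIV"
  shows "g \<bullet> x = (\<Sum>e\<in>E. representation E x e * (g \<bullet> e))"
proof -
  have "x = (\<Sum>e\<in>E. representation E x e *\<^sub>R e)"
    using assms independent_imp_finite by (intro sum_representation_eq[symmetric]) auto
  then have "g \<bullet> x = g \<bullet> (\<Sum>e\<in>E. representation E x e *\<^sub>R e)" by simp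
  then show ?thesis by (simp only: inner_sum_right inner_scaleR_right)
qed

text \<open>
  If \<open>g\<close> were negative on two edges, both coordinates would vanish on the facet, because \<open>g\<close> is
  nonpositive on all edges and points of \<open>S\<close> have nonnegative coordinates. The facet would
  then have codimension at least two.
\<close>

lemma facet_normal_unique_edge:
  fixes S :: "(real ^ 'n) set"
  assumes S: "regular_polytope S" "v \<in> vertices S"
    and facet: "(S \<inter> {x. g \<bullet> x = g \<bullet> v}) facet_of S" and g: "g \<noteq> 0"
    and le: "\<And>e. e \<in> edge_vectors S v \<Longrightarrow> g \<bullet> e \<le> 0"
  shows "\<exists>!e. e \<in> edge_vectors S v \<and> g \<bullet> e < 0"
proof -
  define E where "E = edge_vectors S v"
  have E: "independent E" "span E = UNIV" "finite E"
    using edge_vectors_basis[OF S] span_int_basis independent_imp_finite by (auto simp: E_def)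
  have cardE: "card E = CARD('n)"
    using dim_eq_card_independent[OF E(1)] E(2) dim_span[of E] by simp
  have "\<exists>e\<in>E. g \<bullet> e < 0"
  proof (rule ccontr)
    assume "\<not> ?thesis"
    then have "\<forall>e\<in>E. g \<bullet> e = 0" using le unfolding E_def by force
    then have "g \<bullet> g = 0" using inner_via_representation[OF E(1,2), of g g] by simp
    then show False using g by simp
  qed
  moreover have "e1 = e2" if e: "e1 \<in> E" "g \<bullet> e1 < 0" "e2 \<in> E" "g \<bullet> e2 < 0" for e1 e2
  proof (rule ccontr)
    assume ne: "e1 \<noteq> e2"
    define F where "F = S \<inter> {x. g \<bullet> x = g \<bullet> v}"
    have "(\<lambda>x. x - v) ` F \<subseteq> span (E - {e1, e2})"
    proof clarify
      fix x assume x: "x \<in> F"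
      define c where "c = representation E (x - v)"
      have c0: "0 \<le> c e" if "e \<in> E" for e
        using polytope_in_cone_of_edges[OF S, of x e] x that by (simp add: F_def c_def E_def)
      have "(\<Sum>e\<in>E. c e * - (g \<bullet> e)) = 0"
        using inner_via_representation[OF E(1,2), of g "x - v"] x
        by (simp add: F_def c_def inner_diff_right sum_negf)
      moreover have "0 \<le> c e * - (g \<bullet> e)" if "e \<in> E" for e
        using c0[OF that] le that by (simp add: E_def mult_nonneg_nonpos)
      ultimately have "\<forall>e\<in>E. c e * - (g \<bullet> e) = 0"
        using sum_nonneg_eq_0_iff[OF E(3), of "\<lambda>e. c e * - (g \<bullet> e)"] by simp
      then have "c e1 = 0" "c e2 = 0" using e by auto
      have "x - v = (\<Sum>e\<in>E. c e *\<^sub>R e)"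
        unfolding c_def using E by (intro sum_representation_eq[symmetric]) auto
      also have "\<dots> = (\<Sum>e\<in>E - {e1, e2}. c e *\<^sub>R e)"
        using E(3) \<open>c e1 = 0\<close> \<open>c e2 = 0\<close> by (intro sum.mono_neutral_right) auto
      also have "\<dots> \<in> span (E - {e1, e2})"
        by (intro span_sum span_scale span_base)
      finally show "x - v \<in> span (E - {e1, e2})" .
    qed
    then have "aff_dim ((\<lambda>x. x - v) ` F) \<le> aff_dim (span (E - {e1, e2}))"
      by (rule aff_dim_subset)
    also have "\<dots> = int (card (E - {e1, e2}))"
      using dim_eq_card_independent[OF independent_mono[OF E(1)], of "E - {e1, e2}"]
      by (simp add: aff_dim_subspace)
    also have "\<dots> = int CARD('n) - 2"
    proof -
      have "card {e1, e2} \<le> card E" using e E(3) by (intro card_mono) auto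
      then show ?thesis using e E(3) ne cardE by (simp add: card_Diff_subset of_nat_diff)
    qed
    finally have "aff_dim F \<le> int CARD('n) - 2" by (simp add: aff_dim_translation_eq_subtract)
    moreover have "aff_dim F = aff_dim S - 1" using facet by (simp add: F_def facet_of_def)
    moreover have "aff_dim S = int CARD('n)"
      using S(1) by (simp add: regular_polytope_def simple_polytope_def full_polytope_def)
    ultimately show False by simp
  qed
  ultimately show ?thesis unfolding E_def by blast
qed

text \<open>
  The constraints are the half-spaces of a minimal representation, which correspond to the facets; the
  half-spaces themselves serve as indices. A facet through \<open>v\<close> is paired with the only edge vector
  at \<open>v\<close> that leaves it. Every edge vector \<open>e\<close> is obtained: otherwise a small step from \<open>v\<close> along
  \<open>- e\<close> would stay in \<open>S\<close>, against extremality of \<open>v\<close>.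
\<close>

theorem regular_polytope_simple_inequalities:
  fixes S :: "(real ^ 'n) set"
  assumes S: "regular_polytope S"
  shows "\<exists>(H :: (real ^ 'n) set set) a b edge. simple_inequalities H a b S (vertices S) edge \<and>
           (\<forall>v\<in>vertices S. edge v ` tight H a b v = edge_vectors S v)"
proof -
  note full = full_polytopeD[OF S]
  obtain H where H: "finite H" "S = affine hull S \<inter> \<Inter> H"
      "\<forall>h\<in>H. \<exists>a b. a \<noteq> 0 \<and> h = {x. a \<bullet> x \<le> b}"
      "\<And>H'. H' \<subset> H \<Longrightarrow> S \<subset> affine hull S \<inter> \<Inter> H'"
    using full(3) unfolding polyhedron_Int_affine_minimal by blast
  obtain a b where ab: "\<And>h. h \<in> H \<Longrightarrow> a h \<noteq> 0 \<and> h = {x. a h \<bullet> x \<le> b h}"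
    using H(3) by metis
  have SH: "S = {x. \<forall>h\<in>H. 0 \<le> b h - a h \<bullet> x}"
  proof -
    have "S = \<Inter> H" using H(2) full(4) by auto
    also have "\<dots> = {x. \<forall>h\<in>H. 0 \<le> b h - a h \<bullet> x}" using ab by auto
    finally show ?thesis .
  qed
  have facet: "(S \<inter> {x. a h \<bullet> x = b h}) facet_of S" if "h \<in> H" for h
    using facet_of_polyhedron_explicit[OF H(1,2) ab H(4)] that by blast
  define edge where "edge v h = (THE e. e \<in> edge_vectors S v \<and> a h \<bullet> e < 0)" for v h
  have uniq: "\<exists>!e. e \<in> edge_vectors S v \<and> a h \<bullet> e < 0"
    if v: "v \<in> vertices S" and h: "h \<in> tight H a b v" for v h
  proof -
    have hH: "h \<in> H" "a h \<bullet> v = b h" using h by (auto simp: tight_def)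
    show ?thesis
      using facet_normal_unique_edge[OF S v, of "a h"] facet[OF hH(1)] ab[OF hH(1)]
        tight_normal_nonpos[OF SH h] hH(2) by auto
  qed
  have edge: "edge v h \<in> edge_vectors S v \<and> a h \<bullet> edge v h < 0"
    if "v \<in> vertices S" "h \<in> tight H a b v" for v h
    unfolding edge_def by (rule theI'[OF uniq[OF that]])
  have edge_eq: "edge v h = e"
    if "v \<in> vertices S" "h \<in> tight H a b v" "e \<in> edge_vectors S v" "a h \<bullet> e < 0" for v h e
    using uniq[OF that(1,2)] edge[OF that(1,2)] that(3,4) by blast
  have img: "edge v ` tight H a b v = edge_vectors S v" if v: "v \<in> vertices S" for v
  proof
    show "edge v ` tight H a b v \<subseteq> edge_vectors S v" using edge[OF v] by blast
    show "edge_vectors S v \<subseteq> edge v ` tight H a b v"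
    proof
      fix e assume e: "e \<in> edge_vectors S v"
      have vS: "v \<in> S" using v by (auto simp: vertices_def extreme_point_of_def)
      have "\<exists>h\<in>tight H a b v. a h \<bullet> e < 0"
      proof (rule ccontr)
        assume "\<not> ?thesis"
        then have outward: "a h \<bullet> (- e) \<le> 0" if "h \<in> H" "b h - a h \<bullet> v = 0" for h
          using that unfolding tight_def inner_minus_right by fastforce
        obtain s where s: "s > 0" "v + s *\<^sub>R (- e) \<in> S"
          using small_step[OF H(1) SH vS outward] by auto
        obtain t where t: "t > 0" "v + t *\<^sub>R e \<in> S" using e by (rule edge_vector_step)
        have "e \<noteq> 0" using e by (auto simp: edge_vectors_def primitive_vector_def)
        then show False using not_opposite_steps[OF v _ t s(1)] s(2) by simp
      qed
      then show "e \<in> edge v ` tight H a b v" using edge_eq[OF v _ e] by blast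
    qed
  qed
  have "simple_inequalities H a b S (vertices S) edge"
  proof
    show "finite H" "S = {x. \<forall>h\<in>H. 0 \<le> b h - a h \<bullet> x}" by fact+
    show "bounded S" using full(1) by (rule compact_imp_bounded)
    show "finite (vertices S)"
      using finite_polyhedron_extreme_points[OF full(3)] by (simp add: vertices_def)
    show "vertices S \<subseteq> S" by (auto simp: vertices_def extreme_point_of_def)
    show "\<exists>v\<in>vertices S. tight H a b x \<subseteq> tight H a b v" if x: "x \<in> S" for x
    proof -
      define G where "G = {y\<in>S. \<forall>h\<in>tight H a b x. b h - a h \<bullet> y = 0}"
      have G: "G face_of S"
        unfolding G_def by (rule face_of_tight_inequalities[OF SH]) (auto simp: tight_def)
      have "x \<in> G" using x by (auto simp: G_def tight_def)
      then obtain v where "v extreme_point_of G"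
        using extreme_point_exists_convex[of G] face_of_imp_compact[OF full(2,1) G]
          face_of_imp_convex[OF G] by blast
      then have "v \<in> vertices S" "v \<in> G"
        using extreme_point_of_face[OF G] by (auto simp: vertices_def)
      then show ?thesis by (intro bexI[of _ v]) (auto simp: G_def tight_def)
    qed
    show "span (edge v ` tight H a b v) = UNIV" if "v \<in> vertices S" for v
      unfolding img[OF that] using edge_vectors_basis(1)[OF S that] by (rule span_int_basis)
    show "a h \<bullet> edge v h < 0" if "v \<in> vertices S" "h \<in> tight H a b v" for v h
      using edge[OF that] by blast
    show "a h' \<bullet> edge v h = 0"
      if v: "v \<in> vertices S" and h: "h \<in> tight H a b v" "h' \<in> tight H a b v" and ne: "h' \<noteq> h" for v h h'
    proof (rule ccontr)
      assume "a h' \<bullet> edge v h \<noteq> 0"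
      moreover have "a h' \<bullet> edge v h \<le> 0"
        using tight_normal_nonpos[OF SH h(2)] edge[OF v h(1)] by blast
      ultimately have "a h' \<bullet> edge v h < 0" by simp
      then have eq: "edge v h' = edge v h" using edge_eq[OF v h(2)] edge[OF v h(1)] by blast
      define E where "E = edge_vectors S v"
      have E: "independent E" "span E = UNIV" "finite E"
        using edge_vectors_basis[OF S v] span_int_basis independent_imp_finite by (auto simp: E_def)
      \<comment> \<open>The half-space of a facet through \<open>v\<close> is determined by the edge that leaves it, so different half-spaces have different edges.\<close>
      have "k = {x. 0 \<le> representation E (x - v) (edge v k)}" if k: "k \<in> tight H a b v" for k
      proof -
        have kE: "edge v k \<in> E" using edge[OF v k] by (simp add: E_def)
        have others: "a k \<bullet> e = 0" if "e \<in> E - {edge v k}" for e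
          using tight_normal_nonpos[OF SH k, of e] edge_eq[OF v k, of e] that by (force simp: E_def)
        have "a k \<bullet> x - b k = representation E (x - v) (edge v k) * (a k \<bullet> edge v k)" for x
        proof -
          have "a k \<bullet> x - b k = a k \<bullet> (x - v)" using k by (simp add: tight_def inner_diff_right)
          also have "\<dots> = (\<Sum>e\<in>E. representation E (x - v) e * (a k \<bullet> e))"
            by (rule inner_via_representation[OF E(1,2)])
          also have "\<dots> = representation E (x - v) (edge v k) * (a k \<bullet> edge v k)"
            unfolding sum.remove[OF E(3) kE] using others by simp
          finally show ?thesis .
        qed
        then have iff: "a k \<bullet> x - b k \<le> 0 \<longleftrightarrow> 0 \<le> representation E (x - v) (edge v k)" for x
          using edge[OF v k] by (simp add: mult_le_0_iff)
        have "k = {x. a k \<bullet> x \<le> b k}"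
          by (rule conjunct2[OF ab]) (use k in \<open>simp add: tight_def\<close>)
        also have "\<dots> = {x. 0 \<le> representation E (x - v) (edge v k)}"
          using iff by simp
        finally show ?thesis .
      qed
      from this[OF h(1)] this[OF h(2)] ne show False unfolding eq by blast
    qed
  qed
  then show ?thesis using img by blast
qed

section \<open>Weights of lattice points in a polarized cone\<close>

lemma independent_sum_unique:
  fixes E :: "(real ^ 'n) set"
  assumes E: "independent E" and eq: "(\<Sum>a\<in>E. c a *\<^sub>R a) = (\<Sum>a\<in>E. d a *\<^sub>R a)" and a: "a \<in> E"
  shows "c a = d a"
proof -
  have "(\<Sum>a\<in>E. (c a - d a) *\<^sub>R a) = 0"
    using eq by (simp add: algebra_simps sum_subtractf)
  then have "c a - d a = 0"
    using independentD[OF E independent_imp_finite[OF E] order_refl, of "\<lambda>a. c a - d a" a] a by blast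
  then show ?thesis by simp
qed

definition flip_sign :: "real ^ 'n \<Rightarrow> real ^ 'n \<Rightarrow> int" where
  "flip_sign \<xi> a = (if a \<bullet> \<xi> < 0 then 1 else - 1)"

lemma polarize_eq: "polarize \<xi> a = of_int (flip_sign \<xi> a) *\<^sub>R a"
  by (simp add: polarize_def flip_sign_def)

lemma flip_sign_square: "flip_sign \<xi> a * flip_sign \<xi> a = 1"
  by (simp add: flip_sign_def)

lemma polarized_sum_unique:
  fixes E :: "(real ^ 'n) set"
  assumes E: "independent E"
    and eq: "(\<Sum>a\<in>E. c a *\<^sub>R polarize \<xi> a) = (\<Sum>a\<in>E. d a *\<^sub>R polarize \<xi> a)" and a: "a \<in> E"
  shows "c a = d a"
proof -
  have "(\<Sum>a\<in>E. (c a * of_int (flip_sign \<xi> a)) *\<^sub>R a) = (\<Sum>a\<in>E. (d a * of_int (flip_sign \<xi> a)) *\<^sub>R a)"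
    using eq by (simp add: polarize_eq)
  from independent_sum_unique[OF E this a] show ?thesis
    by (auto simp: flip_sign_def split: if_splits)
qed

lemma cone_coords_eq:
  fixes S :: "(real ^ 'n) set"
  assumes E: "independent (edge_vectors S v)"
    and m: "\<And>a. a \<notin> edge_vectors S v \<Longrightarrow> m a = 0"
    and p: "p = v + (\<Sum>a\<in>edge_vectors S v. real (m a) *\<^sub>R polarize \<xi> a)"
  shows "cone_coords S \<xi> v p = m"
  unfolding cone_coords_def
proof (rule the_equality)
  show "(\<forall>a. a \<notin> edge_vectors S v \<longrightarrow> m a = 0) \<and>
      p = v + (\<Sum>a\<in>edge_vectors S v. real (m a) *\<^sub>R polarize \<xi> a)"
    using m p by blast
  fix l assume l: "(\<forall>a. a \<notin> edge_vectors S v \<longrightarrow> l a = 0) \<and>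
      p = v + (\<Sum>a\<in>edge_vectors S v. real (l a) *\<^sub>R polarize \<xi> a)"
  have "l a = m a" if "a \<in> edge_vectors S v" for a
    using polarized_sum_unique[OF E _ that, of "\<lambda>a. real (l a)" \<xi> "\<lambda>a. real (m a)"] l p by simp
  then show "l = m" using l m by (intro ext) metis
qed

lemma cone_weight_eq_prod:
  fixes S :: "(real ^ 'n) set"
  assumes E: "independent (edge_vectors S v)"
    and \<xi>: "\<And>a. a \<in> edge_vectors S v \<Longrightarrow> a \<bullet> \<xi> \<noteq> 0"
    and m: "\<And>a. a \<notin> edge_vectors S v \<Longrightarrow> m a = 0"
    and p: "p = v + (\<Sum>a\<in>edge_vectors S v. real (m a) *\<^sub>R polarize \<xi> a)"
  shows "cone_weight y S \<xi> v p =
    (\<Prod>a\<in>edge_vectors S v. if m a = 0 then if a \<bullet> \<xi> < 0 then 1 / (1 + y) else y / (1 + y) else 1)"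
proof -
  let ?E = "edge_vectors S v"
  have fin: "finite ?E" using E by (rule independent_imp_finite)
  have "p \<in> polarized_cone S \<xi> v"
    unfolding polarized_cone_def using p by (intro CollectI exI[of _ "\<lambda>a. real (m a)"]) simp
  then have "cone_weight y S \<xi> v p =
      (1 / (1 + y)) ^ card {a\<in>?E. a \<bullet> \<xi> < 0 \<and> m a = 0} * (y / (1 + y)) ^ card {a\<in>?E. a \<bullet> \<xi> > 0 \<and> m a = 0}"
    using cone_coords_eq[OF E m p]
    by (simp add: cone_weight_def r1_def r2_def unflipped_def flipped_def conj_ac)
  also have "\<dots> = (\<Prod>a\<in>?E. if a \<bullet> \<xi> < 0 \<and> m a = 0 then 1 / (1 + y) else 1) *
      (\<Prod>a\<in>?E. if a \<bullet> \<xi> > 0 \<and> m a = 0 then y / (1 + y) else 1)"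
    by (simp flip: prod.inter_filter[OF fin])
  also have "\<dots> = (\<Prod>a\<in>?E. if m a = 0 then if a \<bullet> \<xi> < 0 then 1 / (1 + y) else y / (1 + y) else 1)"
    unfolding prod.distrib[symmetric]
  proof (rule prod.cong[OF refl])
    fix a assume "a \<in> ?E"
    then have "a \<bullet> \<xi> < 0 \<or> a \<bullet> \<xi> > 0" using \<xi> by (metis linorder_neqE_linordered_idom)
    then show "(if a \<bullet> \<xi> < 0 \<and> m a = 0 then 1 / (1 + y) else 1) * (if a \<bullet> \<xi> > 0 \<and> m a = 0 then y / (1 + y) else 1)
        = (if m a = 0 then if a \<bullet> \<xi> < 0 then 1 / (1 + y) else y / (1 + y) else 1)"
      by auto
  qed
  finally show ?thesis .
qed

lemma lattice_point_coordinates: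
  fixes S :: "(real ^ 'n) set"
  assumes E: "int_basis (edge_vectors S v)" and v: "v \<in> int_lattice" and p: "p \<in> int_lattice"
  obtains k :: "real ^ 'n \<Rightarrow> int" where "p - v = (\<Sum>a\<in>edge_vectors S v. of_int (k a) *\<^sub>R a)"
proof -
  have "p - v \<in> int_lattice" using v p by (simp add: int_lattice_def)
  then show ?thesis using int_basis_expand[OF E] that by blast
qed

lemma mem_polarized_cone_iff:
  fixes S :: "(real ^ 'n) set"
  assumes E: "independent (edge_vectors S v)"
    and k: "p - v = (\<Sum>a\<in>edge_vectors S v. of_int (k a) *\<^sub>R a)"
  shows "p \<in> polarized_cone S \<xi> v \<longleftrightarrow> (\<forall>a\<in>edge_vectors S v. 0 \<le> flip_sign \<xi> a * k a)"
proof -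
  have k': "p - v = (\<Sum>a\<in>edge_vectors S v. of_int (flip_sign \<xi> a * k a) *\<^sub>R polarize \<xi> a)"
    unfolding k polarize_eq scaleR_scaleR of_int_mult[symmetric]
    using flip_sign_square[of \<xi>] by (intro sum.cong refl) (simp add: mult.commute mult.left_commute)
  show ?thesis
  proof
    assume "p \<in> polarized_cone S \<xi> v"
    then obtain c where c: "\<And>a. a \<in> edge_vectors S v \<Longrightarrow> 0 \<le> c a"
      "p = v + (\<Sum>a\<in>edge_vectors S v. c a *\<^sub>R polarize \<xi> a)"
      unfolding polarized_cone_def by blast
    then have "(\<Sum>a\<in>edge_vectors S v. c a *\<^sub>R polarize \<xi> a) =
        (\<Sum>a\<in>edge_vectors S v. of_int (flip_sign \<xi> a * k a) *\<^sub>R polarize \<xi> a)"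
      using k' by simp
    then have "c a = of_int (flip_sign \<xi> a * k a)" if "a \<in> edge_vectors S v" for a
      using that by (rule polarized_sum_unique[OF E])
    then show "\<forall>a\<in>edge_vectors S v. 0 \<le> flip_sign \<xi> a * k a"
      using c(1) by (simp del: of_int_mult)
  next
    assume "\<forall>a\<in>edge_vectors S v. 0 \<le> flip_sign \<xi> a * k a"
    then show "p \<in> polarized_cone S \<xi> v"
      unfolding polarized_cone_def
    proof (intro CollectI exI[of _ "\<lambda>a. of_int (flip_sign \<xi> a * k a)"] conjI)
      show "p = v + (\<Sum>a\<in>edge_vectors S v. of_int (flip_sign \<xi> a * k a) *\<^sub>R polarize \<xi> a)"
        unfolding k'[symmetric] by simp
    qed (simp del: of_int_mult)
  qed
qed

lemma cone_lattice_point: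
  fixes S :: "(real ^ 'n) set"
  assumes E: "independent (edge_vectors S v)"
    and k: "p - v = (\<Sum>a\<in>edge_vectors S v. of_int (k a) *\<^sub>R a)"
    and p: "p \<in> polarized_cone S \<xi> v"
  shows "p = v + (\<Sum>a\<in>edge_vectors S v.
             real (if a \<in> edge_vectors S v then nat \<bar>k a\<bar> else 0) *\<^sub>R polarize \<xi> a)"
proof -
  have "of_int (k a) *\<^sub>R a = real (if a \<in> edge_vectors S v then nat \<bar>k a\<bar> else 0) *\<^sub>R polarize \<xi> a"
    if "a \<in> edge_vectors S v" for a
  proof -
    have "0 \<le> flip_sign \<xi> a * k a" using mem_polarized_cone_iff[OF E k] p that by blast
    then show ?thesis using that by (auto simp: flip_sign_def polarize_def split: if_splits)
  qed
  then have "p - v = (\<Sum>a\<in>edge_vectors S v.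
             real (if a \<in> edge_vectors S v then nat \<bar>k a\<bar> else 0) *\<^sub>R polarize \<xi> a)"
    unfolding k by (intro sum.cong refl)
  then show ?thesis by (simp only: diff_eq_eq add.commute[of v])
qed

text \<open>
  The sign of \<open>v\<close> is distributed over the flipped edges. A flipped edge whose coordinate is \<open>0\<close> then
  contributes \<open>- (y / (1 + y)) = 1 / (1 + y) - 1\<close>. If \<open>p\<close> lies outside the cone, some coordinate has the
  wrong sign and its factor is \<open>0\<close> or \<open>1 - 1\<close>.
\<close>

lemma signed_cone_weight:
  fixes S :: "(real ^ 'n) set"
  assumes E: "independent (edge_vectors S v)"
    and \<xi>: "\<And>a. a \<in> edge_vectors S v \<Longrightarrow> a \<bullet> \<xi> \<noteq> 0"
    and k: "p - v = (\<Sum>a\<in>edge_vectors S v. of_int (k a) *\<^sub>R a)"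
    and y: "y \<noteq> -1"
    and c: "\<And>a. c a = (if k a > 0 then 1 else if k a < 0 then 0 else 1 / (1 + y))"
  shows "(-1) ^ card (flipped S \<xi> v) * cone_weight y S \<xi> v p =
    (\<Prod>a\<in>edge_vectors S v. if a \<bullet> \<xi> < 0 then c a else c a - 1)"
proof (cases "p \<in> polarized_cone S \<xi> v")
  case True
  let ?E = "edge_vectors S v"
  let ?w = "\<lambda>a. if nat \<bar>k a\<bar> = 0 then if a \<bullet> \<xi> < 0 then 1 / (1 + y) else y / (1 + y) else 1"
  have fin: "finite ?E" using E by (rule independent_imp_finite)
  have "cone_weight y S \<xi> v p = (\<Prod>a\<in>?E. ?w a)"
    unfolding cone_weight_eq_prod[OF E \<xi> _ cone_lattice_point[OF E k True], simplified]
    by (rule prod.cong) auto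
  moreover have "(-1) ^ card (flipped S \<xi> v) = (\<Prod>a\<in>?E. if a \<bullet> \<xi> > 0 then -1 else 1 :: real)"
    unfolding flipped_def by (simp flip: prod.inter_filter[OF fin])
  ultimately have "(-1) ^ card (flipped S \<xi> v) * cone_weight y S \<xi> v p =
      (\<Prod>a\<in>?E. (if a \<bullet> \<xi> > 0 then -1 else 1) * ?w a)"
    by (simp only: prod.distrib)
  also have "\<dots> = (\<Prod>a\<in>?E. if a \<bullet> \<xi> < 0 then c a else c a - 1)"
  proof (rule prod.cong[OF refl])
    fix a assume a: "a \<in> ?E"
    have "0 \<le> flip_sign \<xi> a * k a" using mem_polarized_cone_iff[OF E k] True a by blast
    moreover have "1 / (1 + y) - 1 = - (y / (1 + y))" using y by (simp add: field_simps)
    ultimately show "(if a \<bullet> \<xi> > 0 then -1 else 1) * ?w a = (if a \<bullet> \<xi> < 0 then c a else c a - 1)"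
      using \<xi>[OF a] by (auto simp: c flip_sign_def split: if_splits)
  qed
  finally show ?thesis .
next
  case False
  then obtain a where a: "a \<in> edge_vectors S v" "flip_sign \<xi> a * k a < 0"
    using mem_polarized_cone_iff[OF E k] by (auto simp: not_le)
  then have "(if a \<bullet> \<xi> < 0 then c a else c a - 1) = 0"
    by (auto simp: c flip_sign_def split: if_splits)
  then have "(\<Prod>a\<in>edge_vectors S v. if a \<bullet> \<xi> < 0 then c a else c a - 1) = 0"
    using a(1) independent_imp_finite[OF E] by (intro prod_zero) blast+
  then show ?thesis using False by (simp add: cone_weight_def)
qed


section \<open>The identity at a single lattice point\<close>

text \<open>
  The identity \<open>vertex_sum_eq_prod\<close> for the polytope itself (\<open>I = {}\<close>) and the values \<open>1\<close>, \<open>1 / (1 + y)\<close>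
  and \<open>0\<close>.
\<close>

theorem signed_cone_weights_eq:
  fixes \<Delta> :: "(real ^ 'n) set"
  assumes S: "regular_polytope \<Delta>" "integral_polytope \<Delta>" and y: "y \<noteq> -1"
    and \<xi>: "polarizing \<Delta> \<xi>" and p: "p \<in> int_lattice"
  shows "(\<Sum>v\<in>vertices \<Delta>. (-1) ^ card (flipped \<Delta> \<xi> v) * cone_weight y \<Delta> \<xi> v p)
       = (if p \<in> \<Delta> then (1 / (1 + y)) ^ face_codim \<Delta> p else 0)"
proof -
  let ?t = "1 / (1 + y)"
  obtain H :: "(real ^ 'n) set set" and a b edge
    where ineq: "simple_inequalities H a b \<Delta> (vertices \<Delta>) edge"
      and img: "\<And>v. v \<in> vertices \<Delta> \<Longrightarrow> edge v ` tight H a b v = edge_vectors \<Delta> v"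
    using regular_polytope_simple_inequalities[OF S(1)] by blast
  interpret simple_inequalities H a b \<Delta> "vertices \<Delta>" edge by (rule ineq)
  define c where "c h = (if 0 < slack h p then 1 else if slack h p < 0 then 0 else ?t)" for h
  have comp: "compatible p c" by (simp add: compatible_def c_def)
  have edge_\<xi>: "edge v h \<bullet> \<xi> \<noteq> 0" if "v \<in> vertices \<Delta>" "h \<in> active v" for v h
    using \<xi> img that unfolding polarizing_def by blast
  have term_eq: "(-1) ^ card (flipped \<Delta> \<xi> v) * cone_weight y \<Delta> \<xi> v p = term_at \<xi> {} c v"
    if v: "v \<in> vertices \<Delta>" for v
  proof -
    have "v \<in> int_lattice" using v S(2) by (auto simp: integral_polytope_def)
    then obtain k :: "real ^ 'n \<Rightarrow> int"
      where k: "p - v = (\<Sum>e\<in>edge_vectors \<Delta> v. of_int (k e) *\<^sub>R e)"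
      using lattice_point_coordinates[OF edge_vectors_basis(1)[OF S(1) v] _ p] by blast
    define c' where "c' e = (if k e > 0 then 1 else if k e < 0 then 0 else ?t)" for e
    have "(-1) ^ card (flipped \<Delta> \<xi> v) * cone_weight y \<Delta> \<xi> v p =
        (\<Prod>e\<in>edge_vectors \<Delta> v. if e \<bullet> \<xi> < 0 then c' e else c' e - 1)"
      using \<xi> v by (intro signed_cone_weight[OF edge_vectors_basis(2)[OF S(1) v] _ k y])
        (auto simp: polarizing_def c'_def)
    also have "\<dots> = (\<Prod>h\<in>active v. if edge v h \<bullet> \<xi> < 0 then c' (edge v h) else c' (edge v h) - 1)"
      unfolding img[OF v, symmetric] prod.reindex[OF inj_on_edge[OF v]] o_def ..
    also have "\<dots> = term_at \<xi> {} c v"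
      unfolding term_at_def Diff_empty
    proof (rule prod.cong[OF refl])
      fix h assume h: "h \<in> active v"
      have "p - v = (\<Sum>h\<in>active v. of_int (k (edge v h)) *\<^sub>R edge v h)"
        unfolding k img[OF v, symmetric] sum.reindex[OF inj_on_edge[OF v]] o_def ..
      from expand_unique[OF v this h]
      have "slack h p = of_int (k (edge v h)) * - (a h \<bullet> edge v h)" .
      then have "c' (edge v h) = c h"
        using decreasing[OF v h] by (auto simp: c_def c'_def zero_less_mult_iff mult_less_0_iff)
      then show "(if edge v h \<bullet> \<xi> < 0 then c' (edge v h) else c' (edge v h) - 1)
          = (if edge v h \<bullet> \<xi> < 0 then c h else c h - 1)" by simp
    qed
    finally show ?thesis .
  qed
  have "\<Delta> \<noteq> {}"
  proof
    assume "\<Delta> = {}"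
    then show False using S(1)
      by (simp add: regular_polytope_def simple_polytope_def full_polytope_def)
  qed
  then obtain v0 where v0: "v0 \<in> vertices \<Delta>" using vertex_exists by blast
  have "(\<Sum>v\<in>vertices \<Delta>. (-1) ^ card (flipped \<Delta> \<xi> v) * cone_weight y \<Delta> \<xi> v p) = vertex_sum \<xi> {} c"
    using term_eq by (simp add: vertex_sum_def)
  also have "\<dots> = prod c H"
    using vertex_sum_eq_prod[OF edge_\<xi> v0, of "{}" p c] comp by simp
  also have "\<dots> = (if p \<in> \<Delta> then ?t ^ face_codim \<Delta> p else 0)"
  proof (cases "p \<in> \<Delta>")
    case True
    have "prod c H = (\<Prod>h\<in>H. if slack h p = 0 then ?t else 1)"
      using True by (intro prod.cong) (auto simp: c_def S_slack)
    also have "\<dots> = ?t ^ card (active p)"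
      unfolding active_def by (simp flip: prod.inter_filter[OF finite_H])
    also have "card (active p) = face_codim \<Delta> p"
    proof -
      obtain v where v: "v \<in> vertices \<Delta>" "active p \<subseteq> active v" using vertex_exists[OF True] by blast
      have "card (active p) \<le> CARD('n)"
        using card_mono[OF finite_active v(2)] card_active[OF v(1)] by simp
      then show ?thesis using least_face_dim[OF True] by (simp add: face_codim_def)
    qed
    finally show ?thesis using True by simp
  next
    case False
    then obtain h where "h \<in> H" "slack h p < 0" by (auto simp: S_slack not_le)
    then have "prod c H = 0" using finite_H by (intro prod_zero) (auto simp: c_def)
    then show ?thesis using False by simp
  qed
  finally show ?thesis .
qed


section \<open>Summation over the lattice\<close>

text \<open>
  In the coordinates of the cone both the weight and the exponential are products over the edge
  vectors; the factor of \<open>a\<close> is a geometric sequence with ratio \<open>exp (polarize \<xi> a \<bullet> \<xi>) < 1\<close>, modified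
  at \<open>0\<close>.
\<close>

lemma cone_weight_summable:
  fixes S :: "(real ^ 'n) set"
  assumes E: "int_basis (edge_vectors S v)" "independent (edge_vectors S v)"
    and v: "v \<in> int_lattice"
    and \<xi>: "\<And>a. a \<in> edge_vectors S v \<Longrightarrow> a \<bullet> \<xi> \<noteq> 0"
  shows "(\<lambda>p. cone_weight y S \<xi> v p * exp (p \<bullet> \<xi>)) summable_on (polarized_cone S \<xi> v \<inter> int_lattice)"
proof -
  let ?E = "edge_vectors S v"
  define g where "g m = v + (\<Sum>a\<in>?E. real (m a) *\<^sub>R polarize \<xi> a)" for m :: "real ^ 'n \<Rightarrow> nat"
  define f where "f a n = (if n = 0 then if a \<bullet> \<xi> < 0 then 1 / (1 + y) else y / (1 + y) else 1)
      * exp (polarize \<xi> a \<bullet> \<xi>) ^ n" for a and n :: nat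
  have bij: "bij_betw g (PiE ?E (\<lambda>_. UNIV)) (polarized_cone S \<xi> v \<inter> int_lattice)"
    unfolding bij_betw_def
  proof
    show "inj_on g (PiE ?E (\<lambda>_. UNIV))"
    proof (rule inj_onI)
      fix m l assume ml: "m \<in> PiE ?E (\<lambda>_. UNIV)" "l \<in> PiE ?E (\<lambda>_. UNIV)" "g m = g l"
      have "m a = l a" if "a \<in> ?E" for a
        using polarized_sum_unique[OF E(2) _ that, of "\<lambda>a. real (m a)" \<xi> "\<lambda>a. real (l a)"] ml(3)
        by (simp add: g_def)
      then show "m = l" using PiE_ext[OF ml(1,2)] by blast
    qed
    show "g ` PiE ?E (\<lambda>_. UNIV) = polarized_cone S \<xi> v \<inter> int_lattice"
    proof
      have "g m \<in> int_lattice" for m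
      proof -
        have "(\<Sum>a\<in>?E. of_int (int (m a) * flip_sign \<xi> a) *\<^sub>R a) \<in> int_lattice"
          using E(1) by (intro int_combination_in_lattice) (auto simp: int_basis_def)
        then have "(\<Sum>a\<in>?E. real (m a) *\<^sub>R polarize \<xi> a) \<in> int_lattice"
          by (simp add: polarize_eq)
        then show ?thesis using v by (simp add: g_def int_lattice_def)
      qed
      moreover have "g m \<in> polarized_cone S \<xi> v" for m
        unfolding polarized_cone_def g_def by (intro CollectI exI[of _ "\<lambda>a. real (m a)"]) simp
      ultimately show "g ` PiE ?E (\<lambda>_. UNIV) \<subseteq> polarized_cone S \<xi> v \<inter> int_lattice" by blast
      show "polarized_cone S \<xi> v \<inter> int_lattice \<subseteq> g ` PiE ?E (\<lambda>_. UNIV)"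
      proof
        fix p assume p: "p \<in> polarized_cone S \<xi> v \<inter> int_lattice"
        obtain k :: "real ^ 'n \<Rightarrow> int" where k: "p - v = (\<Sum>a\<in>?E. of_int (k a) *\<^sub>R a)"
          using lattice_point_coordinates[OF E(1) v] p by blast
        have "p = g (restrict (\<lambda>a. nat \<bar>k a\<bar>) ?E)"
          using cone_lattice_point[OF E(2) k, of \<xi>] p by (simp add: g_def)
        then show "p \<in> g ` PiE ?E (\<lambda>_. UNIV)" by auto
      qed
    qed
  qed
  have "Infinite_Set_Sum.abs_summable_on (f a) UNIV" if a: "a \<in> ?E" for a
  proof -
    have "polarize \<xi> a \<bullet> \<xi> < 0" using \<xi>[OF a] by (auto simp: polarize_def)
    then have "summable (\<lambda>n. exp (polarize \<xi> a \<bullet> \<xi>) ^ n)" by (intro summable_geometric) simp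
    moreover have "eventually (\<lambda>n. norm (f a n) = exp (polarize \<xi> a \<bullet> \<xi>) ^ n) sequentially"
      using eventually_gt_at_top[of 0] by eventually_elim (simp add: f_def)
    ultimately have "summable (\<lambda>n. norm (f a n))" by (simp only: summable_cong)
    then show ?thesis by (simp add: abs_summable_on_nat_iff')
  qed
  then have "Infinite_Set_Sum.abs_summable_on (\<lambda>m. \<Prod>a\<in>?E. f a (m a)) (PiE ?E (\<lambda>_. UNIV))"
    using independent_imp_finite[OF E(2)] by (intro abs_summable_on_prod_PiE) auto
  then have "(\<lambda>m. \<Prod>a\<in>?E. f a (m a)) summable_on PiE ?E (\<lambda>_. UNIV)"
    by (rule abs_summable_summable[OF abs_summable_equivalent[THEN iffD2]])
  then have "(\<lambda>m. exp (v \<bullet> \<xi>) * (\<Prod>a\<in>?E. f a (m a))) summable_on PiE ?E (\<lambda>_. UNIV)"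
    by (rule summable_on_cmult_right)
  moreover have "cone_weight y S \<xi> v (g m) * exp (g m \<bullet> \<xi>) = exp (v \<bullet> \<xi>) * (\<Prod>a\<in>?E. f a (m a))" for m
  proof -
    define m' where "m' a = (if a \<in> ?E then m a else 0)" for a
    have gm: "g m = v + (\<Sum>a\<in>?E. real (m' a) *\<^sub>R polarize \<xi> a)"
      by (simp add: g_def m'_def)
    have m': "m' a = 0" if "a \<notin> ?E" for a
      using that by (simp add: m'_def)
    have "cone_weight y S \<xi> v (g m) =
        (\<Prod>a\<in>?E. if m' a = 0 then if a \<bullet> \<xi> < 0 then 1 / (1 + y) else y / (1 + y) else 1)"
      using \<xi> m' gm by (rule cone_weight_eq_prod[OF E(2)])
    also have "\<dots> = (\<Prod>a\<in>?E. if m a = 0 then if a \<bullet> \<xi> < 0 then 1 / (1 + y) else y / (1 + y) else 1)"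
      by (rule prod.cong) (simp_all add: m'_def)
    finally have "cone_weight y S \<xi> v (g m) =
        (\<Prod>a\<in>?E. if m a = 0 then if a \<bullet> \<xi> < 0 then 1 / (1 + y) else y / (1 + y) else 1)" .
    moreover have "exp (g m \<bullet> \<xi>) = exp (v \<bullet> \<xi>) * (\<Prod>a\<in>?E. exp (polarize \<xi> a \<bullet> \<xi>) ^ m a)"
      using independent_imp_finite[OF E(2)]
      by (simp add: g_def inner_add_left inner_sum_left exp_add exp_sum exp_of_nat_mult)
    ultimately show ?thesis by (simp add: f_def prod.distrib)
  qed
  ultimately show ?thesis
    unfolding summable_on_reindex_bij_betw[OF bij, symmetric] by simp
qed

lemma infsum_finite_sum:
  fixes f :: "'a \<Rightarrow> 'b \<Rightarrow> real"
  assumes "finite A" and "\<And>a. a \<in> A \<Longrightarrow> f a summable_on B"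
  shows "(\<lambda>x. \<Sum>a\<in>A. f a x) summable_on B"
    and "(\<Sum>\<^sub>\<infinity>x\<in>B. \<Sum>a\<in>A. f a x) = (\<Sum>a\<in>A. infsum (f a) B)"
  using assms
  by (induction A rule: finite_induct) (simp_all add: summable_on_add infsum_add)

theorem theorem1:
  fixes \<Delta> :: "(real ^ 'n) set" and \<xi> z :: "real ^ 'n" and y :: real
  assumes "regular_polytope \<Delta>"
    and "integral_polytope \<Delta>"
    and "y \<noteq> -1"
    and "polarizing \<Delta> \<xi>"
    and "\<forall>j. z $ j = exp (\<xi> $ j)"
  shows "(\<forall>v\<in>vertices \<Delta>.
            (\<lambda>p. cone_weight y \<Delta> \<xi> v p * monomial z p) summable_on
              (polarized_cone \<Delta> \<xi> v \<inter> int_lattice)) \<and>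
         (\<Sum>v\<in>vertices \<Delta>. (-1) ^ card (flipped \<Delta> \<xi> v) *
            (\<Sum>\<^sub>\<infinity>p\<in>polarized_cone \<Delta> \<xi> v \<inter> int_lattice.
               cone_weight y \<Delta> \<xi> v p * monomial z p))
         = (\<Sum>p\<in>\<Delta> \<inter> int_lattice. (1 / (1 + y)) ^ face_codim \<Delta> p * monomial z p)"
proof -
  let ?C = "\<lambda>v. polarized_cone \<Delta> \<xi> v \<inter> int_lattice"
  let ?f = "\<lambda>v p. cone_weight y \<Delta> \<xi> v p * monomial z p"
  have "z = (\<chi> j. exp (\<xi> $ j))" using assms(5) by (simp add: vec_eq_iff)
  then have mono: "monomial z p = exp (p \<bullet> \<xi>)" for p by (simp add: monomial_exp)
  have summable: "?f v summable_on ?C v" if v: "v \<in> vertices \<Delta>" for v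
    unfolding mono
  proof (rule cone_weight_summable[OF edge_vectors_basis[OF assms(1) v]])
    show "v \<in> int_lattice" using v assms(2) by (auto simp: integral_polytope_def)
    show "a \<bullet> \<xi> \<noteq> 0" if "a \<in> edge_vectors \<Delta> v" for a
      using assms(4) v that by (auto simp: polarizing_def)
  qed
  have outside: "?f v p = 0" if "p \<in> int_lattice - ?C v" for v p
    using that by (auto simp: cone_weight_def)
  have summable': "?f v summable_on int_lattice" if "v \<in> vertices \<Delta>" for v
    using summable[OF that] outside by (subst summable_on_cong_neutral[where T = "?C v"]) auto
  have fin: "finite (vertices \<Delta>)"
    using finite_polyhedron_extreme_points[OF full_polytopeD(3)[OF assms(1)]] by (simp add: vertices_def)
  have "(\<Sum>v\<in>vertices \<Delta>. (-1) ^ card (flipped \<Delta> \<xi> v) * infsum (?f v) (?C v))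
      = (\<Sum>v\<in>vertices \<Delta>. \<Sum>\<^sub>\<infinity>p\<in>int_lattice. (-1) ^ card (flipped \<Delta> \<xi> v) * ?f v p)"
  proof (intro sum.cong refl)
    fix v
    have "infsum (?f v) (?C v) = infsum (?f v) int_lattice"
      using outside by (intro infsum_cong_neutral) auto
    then show "(-1) ^ card (flipped \<Delta> \<xi> v) * infsum (?f v) (?C v)
        = (\<Sum>\<^sub>\<infinity>p\<in>int_lattice. (-1) ^ card (flipped \<Delta> \<xi> v) * ?f v p)"
      by (simp only: infsum_cmult_right')
  qed
  also have "\<dots> = (\<Sum>\<^sub>\<infinity>p\<in>int_lattice. \<Sum>v\<in>vertices \<Delta>. (-1) ^ card (flipped \<Delta> \<xi> v) * ?f v p)"
    by (rule infsum_finite_sum(2)[OF fin summable_on_cmult_right[OF summable'], symmetric])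
  also have "\<dots> = (\<Sum>\<^sub>\<infinity>p\<in>int_lattice.
      (if p \<in> \<Delta> then (1 / (1 + y)) ^ face_codim \<Delta> p else 0) * monomial z p)"
  proof (rule infsum_cong)
    fix p :: "real ^ 'n" assume "p \<in> int_lattice"
    from signed_cone_weights_eq[OF assms(1-4) this]
    show "(\<Sum>v\<in>vertices \<Delta>. (-1) ^ card (flipped \<Delta> \<xi> v) * ?f v p)
        = (if p \<in> \<Delta> then (1 / (1 + y)) ^ face_codim \<Delta> p else 0) * monomial z p"
      by (simp only: sum_distrib_right mult.assoc[symmetric] flip: sum_distrib_right)
  qed
  also have "\<dots> = (\<Sum>\<^sub>\<infinity>p\<in>\<Delta> \<inter> int_lattice. (1 / (1 + y)) ^ face_codim \<Delta> p * monomial z p)"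
    by (rule infsum_cong_neutral) auto
  also have "\<dots> = (\<Sum>p\<in>\<Delta> \<inter> int_lattice. (1 / (1 + y)) ^ face_codim \<Delta> p * monomial z p)"
    using finite_bounded_int_lattice[OF compact_imp_bounded[OF full_polytopeD(1)[OF assms(1)]]]
    by (rule infsum_finite)
  finally show ?thesis using summable by blast
qed

end
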